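(* Let $\mathbb{K}/\mathbb{F}$ be a separable tamely ramified quadratic extension of non-archimedean local fields, $\mathcal{D}$ a central division $\mathbb{F}$-algebra of even index, $\Delta$ the centralizer of $\mathbb{K}$ in $\mathcal{D}$, and $G=(\mathcal{D}\otimes_{\mathbb{F}}\mathbb{K})^\times\simeq\mathrm{GL}_2(\Delta)$. Let $(\pi,V)$ be a smooth irreducible representation of $G$, in the discrete series, of level $0$, not cuspidal. Let $\varphi=(\varphi_s)_{s\in X_0}$ be a linear form on $C_0$. Then $\varphi\in\mathrm{Hom}_{\mathcal{D}^\times}(C_0,\mathbf{1})\cap\ker(\partial_1^* )$ if and only if: (i) for all adjacent vertices $s$ and $t$, the maps $\varphi_s$ and $\varphi_t$ coincide on $V_{\{s,t\}}$; and (ii) for every $g\in\mathcal{D}^\times$ and every vertex $s$, $\varphi_s=\varphi_{g\cdot s}\circ\pi(g)$.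
   Context: $\mathbb{K}$ is embedded in $\mathcal{D}$; $\mathcal{D}$ is a right $\Delta$-vector space of dimension $2$ and $\mathcal{D}\otimes_{\mathbb{F}}\mathbb{K}\simeq\mathrm{End}_\Delta(\mathcal{D})$ via $x\otimes k\mapsto[y\mapsto xyk]$, so $\mathcal{D}^\times\subset G$. Level $0$ means having a nonzero vector fixed by a conjugate of $1+\varpi_\Delta\mathrm{M}_2(\mathcal{O}_\Delta)$. The Bruhat-Tits tree $X_{\mathbb{K}}$ of $G$ has as vertices the classes $[L]=\{L\varpi_\Delta^i:i\in\mathbb{Z}\}$ of $\mathcal{O}_\Delta$-lattices $L$ of $\mathcal{D}$, with $[L],[L']$ adjacent when representatives satisfy $L\supsetneq L'\supsetneq L\varpi_\Delta$. $X_0$ is the set of vertices, $X_{(1)}$ the set of oriented edges $\langle s,t\rangle$; $s\sim t$ means adjacent. For a vertex or edge $\sigma$, $\mathcal{A}_\sigma$ is the associated hereditary order of $\mathrm{End}_\Delta(\mathcal{D})$, $\mathcal{P}_\sigma$ its Jacobson radical, $\mathcal{U}_\sigma^1=1+\mathcal{P}_\sigma$, and $V_\sigma=V^{\mathcal{U}_\sigma^1}$; one has $V_{\{s,t\}}\subset V_s\cap V_t$. $C_0=\bigoplus_{s\in X_0}V_s$; $C_1$ is the space of finitely supported functions $w$ on $X_{(1)}$ with $w(\langle s,t\rangle)\in V_{\{s,t\}}$ and $w(\langle s,t\rangle)=-w(\langle t,s\rangle)$; $\partial_1:C_1\to C_0$ is $\partial_1(w)(s)=\sum_{t\sim s}w(\langle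 t,s\rangle)$. $G$ acts on $C_0$ by $(g\cdot v)_s=\pi(g)v_{g^{-1}s}$ and on $C_1$ by $(g\cdot w)(\langle s,t\rangle)=\pi(g)w(\langle g^{-1}s,g^{-1}t\rangle)$. $\partial_1^*:\mathrm{Hom}_{\mathcal{D}^\times}(C_0,\mathbf{1})\to\mathrm{Hom}_{\mathcal{D}^\times}(C_1,\mathbf{1})$ is $\varphi\mapsto\varphi\circ\partial_1$. For a linear form $\varphi$ on $C_0$, $\varphi_s$ denotes its restriction to $V_s$. *)

theory Defs
  imports "HOL-Analysis.Analysis" "HOL-Computational_Algebra.Polynomial" "HOL-Algebra.AbelCoset"
begin

section \<open>Local fields and their extensions\<close>

definition unital_hom :: "('a::ring_1 \<Rightarrow> 'b::ring_1) \<Rightarrow> bool" where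
  "unital_hom i \<longleftrightarrow> i 1 = 1 \<and> (\<forall>x y. i (x + y) = i x + i y) \<and> (\<forall>x y. i (x * y) = i x * i y)"

text \<open>The absolute value of a local field extends uniquely to a finite-dimensional division algebra
  \<open>\<D>\<close>, so a local field together with \<open>\<D>\<close> is given by one absolute value on \<open>\<D>\<close>
  whose restriction to the field satisfies \<open>local_field\<close> below.\<close>

definition nonarch_abs :: "('a::division_ring \<Rightarrow> real) \<Rightarrow> bool" where
  "nonarch_abs N \<longleftrightarrow>
     (\<forall>x. 0 \<le> N x \<and> (N x = 0 \<longleftrightarrow> x = 0)) \<and>
     (\<forall>x y. N (x * y) = N x * N y) \<and>
     (\<forall>x y. N (x + y) \<le> max (N x) (N y))"

text \<open>\<open>w\<close> generates the maximal ideal of the valuation ring of the division subring \<open>S\<close>.\<close>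

definition uniformizer :: "('a::division_ring \<Rightarrow> real) \<Rightarrow> 'a set \<Rightarrow> 'a \<Rightarrow> bool" where
  "uniformizer N S w \<longleftrightarrow> w \<in> S \<and> w \<noteq> 0 \<and> N w < 1 \<and> (\<forall>x\<in>S. N x < 1 \<longrightarrow> N x \<le> N w)"

text \<open>The existence of a uniformizer says that the absolute value is discrete and nontrivial.\<close>

definition local_field :: "('a::field \<Rightarrow> real) \<Rightarrow> bool" where
  "local_field N \<longleftrightarrow>
     nonarch_abs N \<and>
     (\<exists>w. uniformizer N UNIV w) \<and>
     Metric_space.mcomplete UNIV (\<lambda>x y. N (x - y)) \<and>
     finite ({x. N x \<le> 1} // {(x, y). N x \<le> 1 \<and> N y \<le> 1 \<and> N (x - y) < 1})"

text \<open>The characteristic of the residue field, i.e. the order of \<open>1\<close> modulo the maximal ideal.\<close>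

definition residue_char :: "('a::field \<Rightarrow> real) \<Rightarrow> nat" where
  "residue_char N = (LEAST p. 0 < p \<and> N (of_nat p) < 1)"

definition ramification_index :: "('f::field \<Rightarrow> real) \<Rightarrow> ('k::field \<Rightarrow> real) \<Rightarrow> nat" where
  "ramification_index NF NK =
     (THE e. \<exists>a b. uniformizer NF UNIV a \<and> uniformizer NK UNIV b \<and> NF a = NK b ^ e)"

text \<open>The residue field extension is automatically separable, the residue fields being finite.
  Unramified extensions are included.\<close>

definition tamely_ramified :: "('f::field \<Rightarrow> real) \<Rightarrow> ('k::field \<Rightarrow> real) \<Rightarrow> bool" where
  "tamely_ramified NF NK \<longleftrightarrow> coprime (ramification_index NF NK) (residue_char NF)"

definition extension_degree :: "('f::field \<Rightarrow> 'a::ring_1) \<Rightarrow> nat" where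
  "extension_degree i = vector_space.dim (\<lambda>a x. i a * x) (UNIV :: 'a set)"

definition separable_extension :: "('f::field \<Rightarrow> 'k::field) \<Rightarrow> bool" where
  "separable_extension i \<longleftrightarrow>
     (\<forall>x. \<exists>p. irreducible p \<and> poly (map_poly i p) x = 0 \<and> coprime p (pderiv p))"

text \<open>\<^const>\<open>extension_degree\<close> is \<open>0\<close> in infinite dimension, so the condition \<open>0 < n\<close> makes
  the algebra finite-dimensional.\<close>

definition central_division_algebra_of_index ::
    "('f::field \<Rightarrow> 'd::division_ring) \<Rightarrow> nat \<Rightarrow> bool" where
  "central_division_algebra_of_index i n \<longleftrightarrow>
     unital_hom i \<and> {z. \<forall>x. z * x = x * z} = range i \<and> 0 < n \<and> extension_degree i = n\<^sup>2"

definition centralizer :: "'d::ring_1 set \<Rightarrow> 'd set" where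
  "centralizer S = {x. \<forall>k\<in>S. x * k = k * x}"

definition int_ring :: "('d::division_ring \<Rightarrow> real) \<Rightarrow> 'd set \<Rightarrow> 'd set" where
  "int_ring N \<Delta> = {x \<in> \<Delta>. N x \<le> 1}"


section \<open>The group \<open>G\<close>\<close>

text \<open>\<open>End_ring \<Delta>\<close> is the ring of endomorphisms of the right \<open>\<Delta>\<close>-vector space \<open>\<D>\<close>, the
  whole type. It is identified with \<open>\<D> \<otimes> \<K>\<close> by letting \<open>x \<otimes> k\<close> act as \<open>y \<mapsto> x y k\<close>, so that
  \<open>G = (\<D> \<otimes> \<K>)\<^sup>\<times>\<close> is its group of units.\<close>

definition End_ring :: "'d::division_ring set \<Rightarrow> ('d \<Rightarrow> 'd) ring" where
  "End_ring \<Delta> = \<lparr>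
     carrier = {f. (\<forall>x y. f (x + y) = f x + f y) \<and> (\<forall>x. \<forall>d\<in>\<Delta>. f (x * d) = f x * d)},
     monoid.mult = (\<lambda>f g. f \<circ> g), one = id,
     zero = (\<lambda>x. 0), add = (\<lambda>f g x. f x + g x)\<rparr>"

definition GL :: "'d::division_ring set \<Rightarrow> ('d \<Rightarrow> 'd) monoid" where
  "GL \<Delta> = units_of (End_ring \<Delta>)"

definition lmult :: "'d::division_ring \<Rightarrow> 'd \<Rightarrow> 'd" where
  "lmult g = (\<lambda>y. g * y)"

lemma End_ring_ring: "ring (End_ring \<Delta>)"
proof (rule ringI)
  show "abelian_group (End_ring \<Delta>)"
  proof (rule abelian_groupI)
    fix f assume f: "f \<in> carrier (End_ring \<Delta>)"
    show "\<exists>g\<in>carrier (End_ring \<Delta>). g \<oplus>\<^bsub>End_ring \<Delta>\<^esub> f = \<zero>\<^bsub>End_ring \<Delta>\<^esub>"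
      using f by (intro bexI[of _ "\<lambda>x. - f x"]) (auto simp: End_ring_def)
  qed (auto simp: End_ring_def algebra_simps)
  show "Group.monoid (End_ring \<Delta>)"
    by (rule monoidI) (auto simp: End_ring_def fun_eq_iff)
qed (auto simp: End_ring_def fun_eq_iff)

lemma tensor_in_End_ring:
  assumes "k \<in> K"
  shows "(\<lambda>y. x * y * k) \<in> carrier (End_ring (centralizer K))"
  using assms by (auto simp: End_ring_def centralizer_def algebra_simps)

lemma lmult_in_GL:
  assumes "g \<noteq> 0"
  shows "lmult g \<in> carrier (GL \<Delta>)"
proof -
  have 1: "lmult h \<in> carrier (End_ring \<Delta>)" for h
    by (auto simp: lmult_def End_ring_def algebra_simps)
  have 2: "lmult (inverse g) \<otimes>\<^bsub>End_ring \<Delta>\<^esub> lmult g = \<one>\<^bsub>End_ring \<Delta>\<^esub>"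
    "lmult g \<otimes>\<^bsub>End_ring \<Delta>\<^esub> lmult (inverse g) = \<one>\<^bsub>End_ring \<Delta>\<^esub>"
    using assms by (auto simp: End_ring_def lmult_def fun_eq_iff mult.assoc [symmetric])
  have "lmult g \<in> Units (End_ring \<Delta>)"
    unfolding Units_def using 1 2 by blast
  then show ?thesis
    by (simp add: GL_def units_of_def)
qed

text \<open>The topology of \<open>G\<close> as a subspace of the finite-dimensional \<open>End_ring \<Delta>\<close>: neighbourhoods
  are given by the operator norm attached to \<open>N\<close>.\<close>

definition GL_topology :: "('d::division_ring \<Rightarrow> real) \<Rightarrow> 'd set \<Rightarrow> ('d \<Rightarrow> 'd) topology" where
  "GL_topology N \<Delta> = topology (\<lambda>U. U \<subseteq> carrier (GL \<Delta>) \<and>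
     (\<forall>g\<in>U. \<exists>r>0. \<forall>h\<in>carrier (GL \<Delta>). (\<forall>x. N (h x - g x) \<le> r * N x) \<longrightarrow> h \<in> U))"

lemma openin_GL_topology:
  assumes "\<And>x. 0 \<le> N x"
  shows "openin (GL_topology N \<Delta>) U \<longleftrightarrow> U \<subseteq> carrier (GL \<Delta>) \<and>
     (\<forall>g\<in>U. \<exists>r>0. \<forall>h\<in>carrier (GL \<Delta>). (\<forall>x. N (h x - g x) \<le> r * N x) \<longrightarrow> h \<in> U)"
proof -
  let ?P = "\<lambda>U. U \<subseteq> carrier (GL \<Delta>) \<and>
     (\<forall>g\<in>U. \<exists>r>0. \<forall>h\<in>carrier (GL \<Delta>). (\<forall>x. N (h x - g x) \<le> r * N x) \<longrightarrow> h \<in> U)"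
  have "istopology ?P"
    unfolding istopology_def
  proof (intro conjI allI impI)
    fix S T assume S: "?P S" and T: "?P T"
    show "S \<inter> T \<subseteq> carrier (GL \<Delta>)" using S by blast
    show "\<forall>g\<in>S \<inter> T. \<exists>r>0. \<forall>h\<in>carrier (GL \<Delta>).
        (\<forall>x. N (h x - g x) \<le> r * N x) \<longrightarrow> h \<in> S \<inter> T"
    proof
      fix g assume g: "g \<in> S \<inter> T"
      obtain r where r: "r > 0"
        "\<forall>h\<in>carrier (GL \<Delta>). (\<forall>x. N (h x - g x) \<le> r * N x) \<longrightarrow> h \<in> S" using S g by blast
      obtain r' where r': "r' > 0"
        "\<forall>h\<in>carrier (GL \<Delta>). (\<forall>x. N (h x - g x) \<le> r' * N x) \<longrightarrow> h \<in> T" using T g by blast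
      have "min r r' * N x \<le> r * N x" "min r r' * N x \<le> r' * N x" for x
        using assms by (simp_all add: mult_right_mono)
      then have "\<forall>h\<in>carrier (GL \<Delta>). (\<forall>x. N (h x - g x) \<le> min r r' * N x) \<longrightarrow> h \<in> S \<inter> T"
        using r r' by (meson Int_iff order_trans)
      then show "\<exists>r>0. \<forall>h\<in>carrier (GL \<Delta>). (\<forall>x. N (h x - g x) \<le> r * N x) \<longrightarrow> h \<in> S \<inter> T"
        using r r' by (intro exI[of _ "min r r'"]) auto
    qed
  next
    fix \<C> assume C: "\<forall>S\<in>\<C>. ?P S"
    then show "\<Union>\<C> \<subseteq> carrier (GL \<Delta>)" by blast
    show "\<forall>g\<in>\<Union>\<C>. \<exists>r>0. \<forall>h\<in>carrier (GL \<Delta>).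
        (\<forall>x. N (h x - g x) \<le> r * N x) \<longrightarrow> h \<in> \<Union>\<C>"
    proof
      fix g assume "g \<in> \<Union>\<C>"
      then obtain S where "S \<in> \<C>" "g \<in> S" by blast
      with C show "\<exists>r>0. \<forall>h\<in>carrier (GL \<Delta>).
          (\<forall>x. N (h x - g x) \<le> r * N x) \<longrightarrow> h \<in> \<Union>\<C>"
        by (meson UnionI)
    qed
  qed
  then show ?thesis by (simp add: GL_topology_def)
qed


section \<open>The Bruhat-Tits tree\<close>

definition right_span :: "'d::division_ring set \<Rightarrow> 'd set \<Rightarrow> 'd set" where
  "right_span R B = {\<Sum>b\<in>B. b * c b |c. \<forall>b\<in>B. c b \<in> R}"

text \<open>Finitely generated right \<open>int_ring N \<Delta>\<close>-submodules spanning \<open>\<D>\<close> over \<open>\<Delta>\<close>.\<close>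

definition lattice :: "('d::division_ring \<Rightarrow> real) \<Rightarrow> 'd set \<Rightarrow> 'd set \<Rightarrow> bool" where
  "lattice N \<Delta> L \<longleftrightarrow>
     (\<exists>B. finite B \<and> L = right_span (int_ring N \<Delta>) B \<and> right_span \<Delta> B = UNIV)"

definition lattice_class :: "'d::division_ring \<Rightarrow> 'd set \<Rightarrow> 'd set set" where
  "lattice_class \<omega> L = {(\<lambda>x. x * \<omega> powi i) ` L |i. True}"

definition vertices :: "('d::division_ring \<Rightarrow> real) \<Rightarrow> 'd set \<Rightarrow> 'd \<Rightarrow> 'd set set set" where
  "vertices N \<Delta> \<omega> = {lattice_class \<omega> L |L. lattice N \<Delta> L}"

definition adjacent ::
    "('d::division_ring \<Rightarrow> real) \<Rightarrow> 'd set \<Rightarrow> 'd \<Rightarrow> 'd set set \<Rightarrow> 'd set set \<Rightarrow> bool" where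
  "adjacent N \<Delta> \<omega> s t \<longleftrightarrow> s \<in> vertices N \<Delta> \<omega> \<and> t \<in> vertices N \<Delta> \<omega> \<and>
     (\<exists>L\<in>s. \<exists>L'\<in>t. L' \<subset> L \<and> (\<lambda>x. x * \<omega>) ` L \<subset> L')"

definition vertex_act :: "('d \<Rightarrow> 'd) \<Rightarrow> 'd set set \<Rightarrow> 'd set set" where
  "vertex_act g s = (\<lambda>L. g ` L) ` s"

text \<open>A simplex \<open>\<sigma>\<close> is given by the set of its vertices: \<open>{s}\<close> for a vertex, \<open>{s, t}\<close> for an
  edge. Its hereditary order stabilizes every lattice of the associated chain.\<close>

definition hereditary_order ::
    "'d::division_ring set \<Rightarrow> 'd set set set \<Rightarrow> ('d \<Rightarrow> 'd) ring" where
  "hereditary_order \<Delta> \<sigma> =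
     (End_ring \<Delta>)\<lparr>carrier := {a \<in> carrier (End_ring \<Delta>). \<forall>s\<in>\<sigma>. \<forall>L\<in>s. a ` L \<subseteq> L}\<rparr>"

definition left_ideal :: "('a, 'm) ring_scheme \<Rightarrow> 'a set \<Rightarrow> bool" where
  "left_ideal R I \<longleftrightarrow>
     additive_subgroup I R \<and> (\<forall>a\<in>carrier R. \<forall>x\<in>I. a \<otimes>\<^bsub>R\<^esub> x \<in> I)"

definition maximal_left_ideal :: "('a, 'm) ring_scheme \<Rightarrow> 'a set \<Rightarrow> bool" where
  "maximal_left_ideal R I \<longleftrightarrow> left_ideal R I \<and> I \<noteq> carrier R \<and>
     (\<forall>J. left_ideal R J \<and> I \<subseteq> J \<longrightarrow> J = I \<or> J = carrier R)"

definition jacobson_radical :: "('a, 'm) ring_scheme \<Rightarrow> 'a set" where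
  "jacobson_radical R = carrier R \<inter> \<Inter>{I. maximal_left_ideal R I}"

definition U1 :: "'d::division_ring set \<Rightarrow> 'd set set set \<Rightarrow> ('d \<Rightarrow> 'd) set" where
  "U1 \<Delta> \<sigma> = {\<lambda>x. x + p x |p. p \<in> jacobson_radical (hereditary_order \<Delta> \<sigma>)}"


section \<open>Representations of \<open>G\<close>\<close>

definition group_rep ::
    "(complex \<Rightarrow> 'v::ab_group_add \<Rightarrow> 'v) \<Rightarrow> ('g, 'm) monoid_scheme \<Rightarrow> ('g \<Rightarrow> 'v \<Rightarrow> 'v) \<Rightarrow> bool" where
  "group_rep scl G \<pi> \<longleftrightarrow>
     vector_space scl \<and>
     (\<forall>g\<in>carrier G. Vector_Spaces.linear scl scl (\<pi> g)) \<and>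
     \<pi> \<one>\<^bsub>G\<^esub> = id \<and>
     (\<forall>g\<in>carrier G. \<forall>h\<in>carrier G. \<pi> (g \<otimes>\<^bsub>G\<^esub> h) = \<pi> g \<circ> \<pi> h)"

definition smooth_rep ::
    "('g, 'm) monoid_scheme \<Rightarrow> 'g topology \<Rightarrow> ('g \<Rightarrow> 'v \<Rightarrow> 'v) \<Rightarrow> bool" where
  "smooth_rep G T \<pi> \<longleftrightarrow> (\<forall>v. openin T {g \<in> carrier G. \<pi> g v = v})"

definition irreducible_rep ::
    "(complex \<Rightarrow> 'v::ab_group_add \<Rightarrow> 'v) \<Rightarrow> ('g, 'm) monoid_scheme \<Rightarrow> ('g \<Rightarrow> 'v \<Rightarrow> 'v) \<Rightarrow> bool" where
  "irreducible_rep scl G \<pi> \<longleftrightarrow>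
     (UNIV :: 'v set) \<noteq> {0} \<and>
     (\<forall>W. module.subspace scl W \<and> (\<forall>g\<in>carrier G. \<pi> g ` W \<subseteq> W) \<longrightarrow> W = {0} \<or> W = UNIV)"

definition fixed_vectors :: "('g \<Rightarrow> 'v \<Rightarrow> 'v) \<Rightarrow> 'g set \<Rightarrow> 'v set" where
  "fixed_vectors \<pi> H = {v. \<forall>h\<in>H. \<pi> h v = v}"

definition group_center :: "('g, 'm) monoid_scheme \<Rightarrow> 'g set" where
  "group_center G = {z \<in> carrier G. \<forall>g\<in>carrier G. z \<otimes>\<^bsub>G\<^esub> g = g \<otimes>\<^bsub>G\<^esub> z}"

definition quotient_topology ::
    "('g, 'm) monoid_scheme \<Rightarrow> 'g topology \<Rightarrow> 'g set \<Rightarrow> 'g set topology" where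
  "quotient_topology G T H = topology (\<lambda>S. S \<subseteq> carrier (G Mod H) \<and>
     openin T {g \<in> carrier G. H #>\<^bsub>G\<^esub> g \<in> S})"

lemma openin_quotient_topology:
  "openin (quotient_topology G T H) S \<longleftrightarrow>
     S \<subseteq> carrier (G Mod H) \<and> openin T {g \<in> carrier G. H #>\<^bsub>G\<^esub> g \<in> S}"
proof -
  have "istopology (\<lambda>S. S \<subseteq> carrier (G Mod H) \<and> openin T {g \<in> carrier G. H #>\<^bsub>G\<^esub> g \<in> S})"
    unfolding istopology_def
  proof (intro conjI allI impI)
    fix S S' assume S: "S \<subseteq> carrier (G Mod H) \<and> openin T {g \<in> carrier G. H #>\<^bsub>G\<^esub> g \<in> S}"
      and S': "S' \<subseteq> carrier (G Mod H) \<and> openin T {g \<in> carrier G. H #>\<^bsub>G\<^esub> g \<in> S'}"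
    show "S \<inter> S' \<subseteq> carrier (G Mod H)" using S by blast
    have eq: "{g \<in> carrier G. H #>\<^bsub>G\<^esub> g \<in> S \<inter> S'} =
        {g \<in> carrier G. H #>\<^bsub>G\<^esub> g \<in> S} \<inter> {g \<in> carrier G. H #>\<^bsub>G\<^esub> g \<in> S'}" by blast
    show "openin T {g \<in> carrier G. H #>\<^bsub>G\<^esub> g \<in> S \<inter> S'}"
      unfolding eq by (rule openin_Int [OF conjunct2 [OF S] conjunct2 [OF S']])
  next
    fix \<C> assume C: "\<forall>S\<in>\<C>. S \<subseteq> carrier (G Mod H) \<and> openin T {g \<in> carrier G. H #>\<^bsub>G\<^esub> g \<in> S}"
    then show "\<Union>\<C> \<subseteq> carrier (G Mod H)" by blast
    have eq: "{g \<in> carrier G. H #>\<^bsub>G\<^esub> g \<in> \<Union>\<C>} =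
        \<Union>((\<lambda>S. {g \<in> carrier G. H #>\<^bsub>G\<^esub> g \<in> S}) ` \<C>)" by blast
    show "openin T {g \<in> carrier G. H #>\<^bsub>G\<^esub> g \<in> \<Union>\<C>}"
      unfolding eq using C by (intro openin_Union) blast
  qed
  then show ?thesis by (simp add: quotient_topology_def)
qed

definition haar_measure :: "('g, 'm) monoid_scheme \<Rightarrow> 'g topology \<Rightarrow> 'g measure \<Rightarrow> bool" where
  "haar_measure G T \<mu> \<longleftrightarrow>
     space \<mu> = topspace T \<and> sets \<mu> = sigma_sets (topspace T) {U. openin T U} \<and>
     (\<forall>g\<in>carrier G. \<forall>A\<in>sets \<mu>. emeasure \<mu> ((\<lambda>x. g \<otimes>\<^bsub>G\<^esub> x) ` A) = emeasure \<mu> A) \<and>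
     (\<forall>C. compactin T C \<longrightarrow> emeasure \<mu> C < \<infinity>) \<and>
     (\<forall>U. openin T U \<and> U \<noteq> {} \<longrightarrow> 0 < emeasure \<mu> U)"

definition smooth_dual ::
    "(complex \<Rightarrow> 'v::ab_group_add \<Rightarrow> 'v) \<Rightarrow> ('g, 'm) monoid_scheme \<Rightarrow> 'g topology \<Rightarrow>
     ('g \<Rightarrow> 'v \<Rightarrow> 'v) \<Rightarrow> ('v \<Rightarrow> complex) set" where
  "smooth_dual scl G T \<pi> =
     {l. Vector_Spaces.linear scl (*) l \<and>
        (\<exists>H. subgroup H G \<and> openin T H \<and> (\<forall>h\<in>H. \<forall>v. l (\<pi> h v) = l v))}"

text \<open>Unitary central character, and square-integrable matrix coefficients modulo the center \<open>Z\<close>.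
  Since the central character is unitary, the absolute value of a coefficient is constant on each
  coset of \<open>Z\<close>, so the choice of the representative is immaterial. A Haar measure of \<open>G / Z\<close> is
  unique up to a positive factor.\<close>

definition discrete_series ::
    "(complex \<Rightarrow> 'v::ab_group_add \<Rightarrow> 'v) \<Rightarrow> ('g, 'm) monoid_scheme \<Rightarrow> 'g topology \<Rightarrow>
     ('g \<Rightarrow> 'v \<Rightarrow> 'v) \<Rightarrow> bool" where
  "discrete_series scl G T \<pi> \<longleftrightarrow>
     (\<forall>z\<in>group_center G. \<exists>c. cmod c = 1 \<and> (\<forall>v. \<pi> z v = scl c v)) \<and>
     (\<exists>\<mu>. haar_measure (G Mod group_center G) (quotient_topology G T (group_center G)) \<mu> \<and>
       (\<forall>v. \<forall>l\<in>smooth_dual scl G T \<pi>.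
         (\<integral>\<^sup>+ C. ennreal ((cmod (l (\<pi> (SOME g. g \<in> C) v)))\<^sup>2) \<partial>\<mu>) < \<infinity>))"

definition right_basis :: "'d::division_ring set \<Rightarrow> 'd \<Rightarrow> 'd \<Rightarrow> bool" where
  "right_basis \<Delta> e f \<longleftrightarrow> (\<forall>x. \<exists>!(a, b). a \<in> \<Delta> \<and> b \<in> \<Delta> \<and> x = e * a + f * b)"

text \<open>The subgroup \<open>1 + \<omega> M\<^sub>2(int_ring N \<Delta>)\<close> of \<open>GL\<^sub>2(\<Delta>)\<close>, matrices being taken in the basis
  \<open>(e, f)\<close>.\<close>

definition principal_subgroup ::
    "('d::division_ring \<Rightarrow> real) \<Rightarrow> 'd set \<Rightarrow> 'd \<Rightarrow> 'd \<Rightarrow> 'd \<Rightarrow> ('d \<Rightarrow> 'd) set" where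
  "principal_subgroup N \<Delta> \<omega> e f = {g \<in> carrier (GL \<Delta>).
     \<exists>a\<in>int_ring N \<Delta>. \<exists>b\<in>int_ring N \<Delta>. \<exists>c\<in>int_ring N \<Delta>. \<exists>d\<in>int_ring N \<Delta>.
       g e = e * (1 + \<omega> * a) + f * (\<omega> * c) \<and> g f = e * (\<omega> * b) + f * (1 + \<omega> * d)}"

definition level_zero ::
    "('d::division_ring \<Rightarrow> real) \<Rightarrow> 'd set \<Rightarrow> 'd \<Rightarrow> (('d \<Rightarrow> 'd) \<Rightarrow> 'v::ab_group_add \<Rightarrow> 'v) \<Rightarrow> bool" where
  "level_zero N \<Delta> \<omega> \<pi> \<longleftrightarrow>
     (\<exists>e f. right_basis \<Delta> e f \<and>
       (\<exists>h\<in>carrier (GL \<Delta>). \<exists>v. v \<noteq> 0 \<and>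
         v \<in> fixed_vectors \<pi>
           ((\<lambda>u. h \<otimes>\<^bsub>GL \<Delta>\<^esub> u \<otimes>\<^bsub>GL \<Delta>\<^esub> inv\<^bsub>GL \<Delta>\<^esub> h) ` principal_subgroup N \<Delta> \<omega> e f)))"

text \<open>The unipotent radical of the stabilizer of the line \<open>e\<Delta>\<close>. These stabilizers are the proper
  parabolic subgroups of \<open>G\<close>.\<close>

definition unipotent_radical :: "'d::division_ring set \<Rightarrow> 'd \<Rightarrow> ('d \<Rightarrow> 'd) set" where
  "unipotent_radical \<Delta> e =
     {g \<in> carrier (GL \<Delta>). g e = e \<and> (\<forall>y. \<exists>d\<in>\<Delta>. g y - y = e * d)}"

text \<open>All proper Jacquet modules vanish.\<close>

definition cuspidal ::
    "(complex \<Rightarrow> 'v::ab_group_add \<Rightarrow> 'v) \<Rightarrow> 'd::division_ring set \<Rightarrow>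
     (('d \<Rightarrow> 'd) \<Rightarrow> 'v \<Rightarrow> 'v) \<Rightarrow> bool" where
  "cuspidal scl \<Delta> \<pi> \<longleftrightarrow>
     (\<forall>e. e \<noteq> 0 \<longrightarrow>
       module.span scl {\<pi> n v - v |n v. n \<in> unipotent_radical \<Delta> e} = UNIV)"


section \<open>Chains on the tree\<close>

definition V_at ::
    "'d::division_ring set \<Rightarrow> (('d \<Rightarrow> 'd) \<Rightarrow> 'v \<Rightarrow> 'v) \<Rightarrow> 'd set set set \<Rightarrow> 'v set" where
  "V_at \<Delta> \<pi> \<sigma> = fixed_vectors \<pi> (U1 \<Delta> \<sigma>)"

definition C0 ::
    "('d::division_ring \<Rightarrow> real) \<Rightarrow> 'd set \<Rightarrow> 'd \<Rightarrow> (('d \<Rightarrow> 'd) \<Rightarrow> 'v::ab_group_add \<Rightarrow> 'v) \<Rightarrow>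
     ('d set set \<Rightarrow> 'v) set" where
  "C0 N \<Delta> \<omega> \<pi> = {f. finite {s. f s \<noteq> 0} \<and>
     (\<forall>s. if s \<in> vertices N \<Delta> \<omega> then f s \<in> V_at \<Delta> \<pi> {s} else f s = 0)}"

text \<open>The oriented edge \<open>\<langle>s,t\<rangle>\<close> is the pair \<open>(s, t)\<close>; chains vanish on pairs that are not edges.\<close>

definition C1 ::
    "('d::division_ring \<Rightarrow> real) \<Rightarrow> 'd set \<Rightarrow> 'd \<Rightarrow> (('d \<Rightarrow> 'd) \<Rightarrow> 'v::ab_group_add \<Rightarrow> 'v) \<Rightarrow>
     ('d set set \<times> 'd set set \<Rightarrow> 'v) set" where
  "C1 N \<Delta> \<omega> \<pi> = {w. finite {e. w e \<noteq> 0} \<and>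
     (\<forall>s t. if adjacent N \<Delta> \<omega> s t
        then w (s, t) \<in> V_at \<Delta> \<pi> {s, t} \<and> w (s, t) = - w (t, s) else w (s, t) = 0)}"

text \<open>The sum over all \<open>t \<sim> s\<close>, restricted to its nonzero terms so that it is visibly finite.\<close>

definition boundary ::
    "('d::division_ring \<Rightarrow> real) \<Rightarrow> 'd set \<Rightarrow> 'd \<Rightarrow>
     ('d set set \<times> 'd set set \<Rightarrow> 'v::ab_group_add) \<Rightarrow> 'd set set \<Rightarrow> 'v" where
  "boundary N \<Delta> \<omega> w s = (\<Sum>t | adjacent N \<Delta> \<omega> t s \<and> w (t, s) \<noteq> 0. w (t, s))"

definition C0_act ::
    "'d::division_ring set \<Rightarrow> (('d \<Rightarrow> 'd) \<Rightarrow> 'v \<Rightarrow> 'v) \<Rightarrow> ('d \<Rightarrow> 'd) \<Rightarrow>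
     ('d set set \<Rightarrow> 'v) \<Rightarrow> 'd set set \<Rightarrow> 'v" where
  "C0_act \<Delta> \<pi> g f = (\<lambda>s. \<pi> g (f (vertex_act (inv\<^bsub>GL \<Delta>\<^esub> g) s)))"

text \<open>Linear forms on a subspace \<open>C\<close> are represented by functions of which only the values on
  \<open>C\<close> matter.\<close>

definition linear_form_on ::
    "(complex \<Rightarrow> 'v::ab_group_add \<Rightarrow> 'v) \<Rightarrow> ('i \<Rightarrow> 'v) set \<Rightarrow> (('i \<Rightarrow> 'v) \<Rightarrow> complex) \<Rightarrow> bool" where
  "linear_form_on scl C \<phi> \<longleftrightarrow>
     (\<forall>x\<in>C. \<forall>y\<in>C. \<phi> (\<lambda>i. x i + y i) = \<phi> x + \<phi> y) \<and>
     (\<forall>c. \<forall>x\<in>C. \<phi> (\<lambda>i. scl c (x i)) = c * \<phi> x)"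

definition Hom_C0 ::
    "(complex \<Rightarrow> 'v::ab_group_add \<Rightarrow> 'v) \<Rightarrow> ('d::division_ring \<Rightarrow> real) \<Rightarrow> 'd set \<Rightarrow> 'd \<Rightarrow>
     (('d \<Rightarrow> 'd) \<Rightarrow> 'v \<Rightarrow> 'v) \<Rightarrow> (('d set set \<Rightarrow> 'v) \<Rightarrow> complex) set" where
  "Hom_C0 scl N \<Delta> \<omega> \<pi> = {\<phi>. linear_form_on scl (C0 N \<Delta> \<omega> \<pi>) \<phi> \<and>
     (\<forall>g. g \<noteq> 0 \<longrightarrow> (\<forall>x\<in>C0 N \<Delta> \<omega> \<pi>. \<phi> (C0_act \<Delta> \<pi> (lmult g) x) = \<phi> x))}"

definition coboundary ::
    "('d::division_ring \<Rightarrow> real) \<Rightarrow> 'd set \<Rightarrow> 'd \<Rightarrow> (('d set set \<Rightarrow> 'v::ab_group_add) \<Rightarrow> complex) \<Rightarrow>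
     ('d set set \<times> 'd set set \<Rightarrow> 'v) \<Rightarrow> complex" where
  "coboundary N \<Delta> \<omega> \<phi> = \<phi> \<circ> boundary N \<Delta> \<omega>"

definition ker_coboundary ::
    "(complex \<Rightarrow> 'v::ab_group_add \<Rightarrow> 'v) \<Rightarrow> ('d::division_ring \<Rightarrow> real) \<Rightarrow> 'd set \<Rightarrow> 'd \<Rightarrow>
     (('d \<Rightarrow> 'd) \<Rightarrow> 'v \<Rightarrow> 'v) \<Rightarrow> (('d set set \<Rightarrow> 'v) \<Rightarrow> complex) set" where
  "ker_coboundary scl N \<Delta> \<omega> \<pi> = {\<phi> \<in> Hom_C0 scl N \<Delta> \<omega> \<pi>.
     \<forall>w\<in>C1 N \<Delta> \<omega> \<pi>. coboundary N \<Delta> \<omega> \<phi> w = 0}"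

text \<open>The restriction \<open>\<phi>\<^sub>s\<close> of a linear form on \<open>C\<^sub>0\<close> to its summand \<open>V\<^sub>s\<close>.\<close>

definition component :: "(('i \<Rightarrow> 'v::ab_group_add) \<Rightarrow> complex) \<Rightarrow> 'i \<Rightarrow> 'v \<Rightarrow> complex" where
  "component \<phi> s v = \<phi> (\<lambda>t. if t = s then v else 0)"

end

theory Submission
  imports Defs "HOL-Algebra.Subrings"
begin

text \<open>
  Everything is formal once \<open>V\<^bsub>{s,t}\<^esub> \<subseteq> V\<^sub>s\<close> is known for adjacent \<open>s\<close> and \<open>t\<close>, that is, once the
  Jacobson radical of the order of a vertex is contained in that of the order of an edge through it.
  An element \<open>x\<close> lies in the Jacobson radical iff \<open>1 - r x\<close> has a left inverse for every \<open>r\<close>. The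
  radical of the order of \<open>s = [L]\<close> maps \<open>L\<close> into \<open>L \<omega>\<close>; if \<open>L \<omega> \<subset> L' \<subset> L\<close>, it therefore stabilizes
  \<open>L'\<close>, and so do the left inverses of \<open>1 - r x\<close> for \<open>r\<close> in the order of the edge.

  A chain that is \<open>v\<close> on one oriented edge and \<open>- v\<close> on its opposite then shows that a form killing
  all boundaries satisfies (i); conversely, under (i), the value of the form on a boundary is a sum
  over oriented edges that changes sign when all orientations are reversed.
\<close>

section \<open>The Jacobson radical\<close>

context ring
begin

text \<open>Negation is left multiplication by \<open>\<ominus> \<one>\<close>, so closure under it
  follows from \<open>mult\<close>.\<close>

lemma left_idealI:
  assumes "I \<subseteq> carrier R" "\<zero> \<in> I" "\<And>x y. x \<in> I \<Longrightarrow> y \<in> I \<Longrightarrow> x \<oplus> y \<in> I"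
    and mult: "\<And>a x. a \<in> carrier R \<Longrightarrow> x \<in> I \<Longrightarrow> a \<otimes> x \<in> I"
  shows "left_ideal R I"
proof -
  have "\<ominus> x \<in> I" if "x \<in> I" for x
    using mult[of "\<ominus> \<one>" x] that assms(1) by (auto simp: l_minus subset_iff)
  then have "subgroup I (add_monoid R)"
    using assms by (intro add.subgroupI) (auto simp: a_inv_def)
  then show ?thesis
    using mult by (simp add: left_ideal_def additive_subgroup_def)
qed

lemma left_idealD:
  assumes "left_ideal R I"
  shows "I \<subseteq> carrier R" "\<zero> \<in> I" "\<And>x y. x \<in> I \<Longrightarrow> y \<in> I \<Longrightarrow> x \<oplus> y \<in> I"
    "\<And>a x. a \<in> carrier R \<Longrightarrow> x \<in> I \<Longrightarrow> a \<otimes> x \<in> I"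
proof -
  interpret additive_subgroup I R
    using assms by (simp add: left_ideal_def)
  show "I \<subseteq> carrier R" "\<zero> \<in> I" "\<And>x y. x \<in> I \<Longrightarrow> y \<in> I \<Longrightarrow> x \<oplus> y \<in> I"
    by (auto simp: a_subset)
  show "\<And>a x. a \<in> carrier R \<Longrightarrow> x \<in> I \<Longrightarrow> a \<otimes> x \<in> I"
    using assms by (simp add: left_ideal_def)
qed

lemma left_ideal_one:
  assumes "left_ideal R I" "\<one> \<in> I"
  shows "I = carrier R"
  using left_idealD(1)[OF assms(1)] left_idealD(4)[OF assms(1) _ assms(2)] by fastforce

text \<open>Serves two purposes in \<open>jacobson_radical_iff\<close>: with
  \<open>I = {\<zero>}\<close> it is the left ideal generated by one element, with \<open>I\<close>
  maximal it is the enlargement that must be the whole ring.\<close>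

lemma left_ideal_sum_principal:
  assumes I: "left_ideal R I" and x: "x \<in> carrier R"
  shows "left_ideal R {m \<oplus> r \<otimes> x |m r. m \<in> I \<and> r \<in> carrier R}" (is "left_ideal R ?J")
proof (rule left_idealI)
  note D = left_idealD[OF I]
  show "?J \<subseteq> carrier R" using D(1) x by auto
  have "\<zero> = \<zero> \<oplus> \<zero> \<otimes> x" using x by simp
  then show "\<zero> \<in> ?J" using D(2) by blast
  fix y assume "y \<in> ?J"
  then obtain m r where y: "y = m \<oplus> r \<otimes> x" "m \<in> I" "r \<in> carrier R" by blast
  then have m: "m \<in> carrier R" using D(1) by blast
  {
    fix z assume "z \<in> ?J"
    then obtain m' r' where z: "z = m' \<oplus> r' \<otimes> x" "m' \<in> I" "r' \<in> carrier R" by blast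
    then have "m' \<in> carrier R" using D(1) by blast
    then have "y \<oplus> z = (m \<oplus> m') \<oplus> (r \<oplus> r') \<otimes> x"
      using x y z m by (simp add: l_distr a_ac)
    then show "y \<oplus> z \<in> ?J" using y z D(3) by blast
  next
    fix a assume a: "a \<in> carrier R"
    then have "a \<otimes> y = a \<otimes> m \<oplus> (a \<otimes> r) \<otimes> x"
      using x y m by (simp add: r_distr m_assoc)
    then show "a \<otimes> y \<in> ?J" using y a D(4) by blast
  }
qed

lemma left_ideal_zero: "left_ideal R {\<zero>}"
  by (rule left_idealI) auto

text \<open>Zorn's lemma applies to the left ideals over \<open>I\<close> that avoid
  \<open>\<one>\<close>: being proper is tested on a single element, hence passes to the union of a
  chain.\<close>

lemma ex_maximal_left_ideal:
  assumes I: "left_ideal R I" "\<one> \<notin> I"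
  obtains M where "maximal_left_ideal R M" "I \<subseteq> M"
proof -
  let ?A = "{J. left_ideal R J \<and> I \<subseteq> J \<and> \<one> \<notin> J}"
  have "\<exists>M\<in>?A. \<forall>X\<in>?A. M \<subseteq> X \<longrightarrow> X = M"
  proof (rule subset_Zorn_nonempty)
    show "?A \<noteq> {}" using I by blast
    fix C assume C: "C \<noteq> {}" "subset.chain ?A C"
    then have CA: "\<And>J. J \<in> C \<Longrightarrow> left_ideal R J \<and> I \<subseteq> J \<and> \<one> \<notin> J"
      and tot: "\<And>J K. J \<in> C \<Longrightarrow> K \<in> C \<Longrightarrow> J \<subseteq> K \<or> K \<subseteq> J"
      by (auto simp: subset_chain_def)
    have "left_ideal R (\<Union>C)"
    proof (rule left_idealI)
      show "\<Union>C \<subseteq> carrier R" using CA left_idealD(1) by blast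
      show "\<zero> \<in> \<Union>C" using C CA left_idealD(2) by blast
      show "x \<oplus> y \<in> \<Union>C" if "x \<in> \<Union>C" "y \<in> \<Union>C" for x y
      proof -
        obtain J K where JK: "J \<in> C" "x \<in> J" "K \<in> C" "y \<in> K" using \<open>x \<in> \<Union>C\<close> \<open>y \<in> \<Union>C\<close> by blast
        with tot[of J K] obtain M where "M \<in> C" "x \<in> M" "y \<in> M" by blast
        then show ?thesis using CA left_idealD(3) by blast
      qed
      show "a \<otimes> x \<in> \<Union>C" if "a \<in> carrier R" "x \<in> \<Union>C" for a x
        using that CA left_idealD(4) by blast
    qed
    then show "\<Union>C \<in> ?A" using C CA by blast
  qed
  then obtain M where M: "M \<in> ?A" and max: "\<forall>X\<in>?A. M \<subseteq> X \<longrightarrow> X = M" by (rule bexE)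
  have "maximal_left_ideal R M"
    unfolding maximal_left_ideal_def
  proof (intro conjI allI impI)
    show "left_ideal R M" "M \<noteq> carrier R" using M(1) by auto
    fix J assume J: "left_ideal R J \<and> M \<subseteq> J"
    show "J = M \<or> J = carrier R"
    proof (cases "\<one> \<in> J")
      case True
      then show ?thesis using J left_ideal_one by blast
    next
      case False
      with J M have "J \<in> ?A" by auto
      with max J show ?thesis by simp
    qed
  qed
  then show ?thesis using M(1) that by blast
qed

text \<open>If \<open>1 - r x\<close> had no left inverse, it would lie in some maximal left ideal;
  this ideal contains \<open>r x\<close> as well, hence \<open>1\<close>. Conversely, if a maximal
  \<open>M\<close> misses \<open>x\<close>, then \<open>1 = m + r x\<close> with \<open>m\<close> in
  \<open>M\<close>, and a left inverse of \<open>m = 1 - r x\<close> puts \<open>1\<close> into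
  \<open>M\<close>.\<close>

lemma jacobson_radical_iff:
  "x \<in> jacobson_radical R \<longleftrightarrow>
     x \<in> carrier R \<and> (\<forall>r\<in>carrier R. \<exists>u\<in>carrier R. u \<otimes> (\<one> \<ominus> r \<otimes> x) = \<one>)"
    (is "?J \<longleftrightarrow> _ \<and> ?U")
proof (intro iffI conjI)
  assume J: ?J
  then show x: "x \<in> carrier R" by (simp add: jacobson_radical_def)
  show ?U
  proof (rule ballI, rule ccontr)
    fix r assume r: "r \<in> carrier R" and no: "\<not> (\<exists>u\<in>carrier R. u \<otimes> (\<one> \<ominus> r \<otimes> x) = \<one>)"
    define a where "a = \<one> \<ominus> r \<otimes> x"
    have a: "a \<in> carrier R" using r x by (simp add: a_def)
    define I where "I = {m \<oplus> u \<otimes> a |m u. m \<in> {\<zero>} \<and> u \<in> carrier R}"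
    have I: "left_ideal R I"
      unfolding I_def by (rule left_ideal_sum_principal[OF left_ideal_zero a])
    have "\<one> \<notin> I" using no a by (auto simp: I_def a_def)
    then obtain M where M: "maximal_left_ideal R M" "I \<subseteq> M" using ex_maximal_left_ideal I by blast
    then have LM: "left_ideal R M" and "M \<noteq> carrier R" by (auto simp: maximal_left_ideal_def)
    have "a = \<zero> \<oplus> \<one> \<otimes> a" using a by simp
    then have "a \<in> M" using M(2) by (auto simp: I_def)
    moreover have "r \<otimes> x \<in> M"
      using J M(1) r left_idealD(4)[OF LM] by (auto simp: jacobson_radical_def)
    ultimately have "a \<oplus> r \<otimes> x \<in> M" using left_idealD(3)[OF LM] by blast
    moreover have "a \<oplus> r \<otimes> x = \<one>"
      using r x by (simp add: a_def minus_eq a_assoc l_neg)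
    ultimately show False using left_ideal_one[OF LM] \<open>M \<noteq> carrier R\<close> by simp
  qed
next
  assume "x \<in> carrier R \<and> ?U"
  then have x: "x \<in> carrier R" and U: ?U by auto
  have "x \<in> M" if M: "maximal_left_ideal R M" for M
  proof (rule ccontr)
    assume xM: "x \<notin> M"
    have LM: "left_ideal R M" and ne: "M \<noteq> carrier R"
      and max: "\<And>J. left_ideal R J \<Longrightarrow> M \<subseteq> J \<Longrightarrow> J = M \<or> J = carrier R"
      using M by (auto simp: maximal_left_ideal_def)
    let ?K = "{m \<oplus> r \<otimes> x |m r. m \<in> M \<and> r \<in> carrier R}"
    have "m = m \<oplus> \<zero> \<otimes> x" if "m \<in> M" for m
      using that x left_idealD(1)[OF LM] by auto
    then have MK: "M \<subseteq> ?K" by blast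
    have "x = \<zero> \<oplus> \<one> \<otimes> x" using x by simp
    then have "x \<in> ?K" using left_idealD(2)[OF LM] by blast
    then have "?K = carrier R"
      using max[OF left_ideal_sum_principal[OF LM x] MK] xM by blast
    then have "\<one> \<in> ?K" by simp
    then obtain m r where mr: "\<one> = m \<oplus> r \<otimes> x" "m \<in> M" "r \<in> carrier R" by auto
    then have mC: "m \<in> carrier R" using left_idealD(1)[OF LM] by blast
    have "m = \<one> \<ominus> r \<otimes> x"
      using mr mC x by (simp add: minus_eq a_assoc r_neg)
    then obtain u where "u \<in> carrier R" "u \<otimes> m = \<one>" using U mr(3) by auto
    then have "\<one> \<in> M" using left_idealD(4)[OF LM _ mr(2)] by metis
    then show False using left_ideal_one[OF LM] ne by blast
  qed
  then show ?J using x by (auto simp: jacobson_radical_def)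
qed

end

section \<open>Lattices and their orders\<close>

text \<open>Left multiplication commutes with right scalars. Coefficients are functions of the
  generator, so they are carried along the bijection between the two generating sets. This makes
  left multiplication send lattices to lattices.\<close>

lemma right_span_image_mult:
  fixes g :: "'d::division_ring"
  assumes "g \<noteq> 0"
  shows "right_span R ((*) g ` B) = (*) g ` right_span R B"
proof -
  have inj: "inj_on ((*) g) B"
    using assms by (simp add: inj_on_def)
  have 1: "(\<Sum>b\<in>(*) g ` B. b * c b) = g * (\<Sum>b\<in>B. b * c (g * b))" for c
    by (simp add: sum.reindex[OF inj] sum_distrib_left mult.assoc)
  have 2: "g * (\<Sum>b\<in>B. b * c b) = (\<Sum>b\<in>(*) g ` B. b * c (inverse g * b))" for c
    using assms by (simp add: sum.reindex[OF inj] sum_distrib_left mult.assoc[symmetric])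
  show ?thesis
  proof (intro equalityI subsetI)
    fix x assume "x \<in> right_span R ((*) g ` B)"
    then obtain c where c: "x = (\<Sum>b\<in>(*) g ` B. b * c b)" "\<forall>b\<in>(*) g ` B. c b \<in> R"
      by (auto simp: right_span_def)
    then have "(\<Sum>b\<in>B. b * c (g * b)) \<in> right_span R B"
      unfolding right_span_def by (intro CollectI exI[of _ "\<lambda>b. c (g * b)"]) auto
    then show "x \<in> (*) g ` right_span R B" using c(1) 1 by auto
  next
    fix x assume "x \<in> (*) g ` right_span R B"
    then obtain c where c: "x = g * (\<Sum>b\<in>B. b * c b)" "\<forall>b\<in>B. c b \<in> R"
      by (auto simp: right_span_def)
    then show "x \<in> right_span R ((*) g ` B)"
      unfolding right_span_def 2
      using assms by (intro CollectI exI[of _ "\<lambda>b. c (inverse g * b)"]) (auto simp: mult.assoc[symmetric])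
  qed
qed

text \<open>What the tree requires of \<Delta>. It is a set with closure axioms rather than a type
  because it will be a centralizer inside \<D>, and \<open>N\<close> lives on all of \<D>.\<close>

locale valued_division_subring =
  fixes N :: "'d::division_ring \<Rightarrow> real" and \<Delta> :: "'d set" and \<omega> :: 'd
  assumes nonarch: "nonarch_abs N"
    and one_in: "1 \<in> \<Delta>"
    and diff_in: "x \<in> \<Delta> \<Longrightarrow> y \<in> \<Delta> \<Longrightarrow> x - y \<in> \<Delta>"
    and mult_in: "x \<in> \<Delta> \<Longrightarrow> y \<in> \<Delta> \<Longrightarrow> x * y \<in> \<Delta>"
    and inverse_in: "x \<in> \<Delta> \<Longrightarrow> inverse x \<in> \<Delta>"
    and uniformizer: "uniformizer N \<Delta> \<omega>"
begin

section \<open>The absolute value and the valuation ring\<close>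

abbreviation \<O> :: "'d set" where "\<O> \<equiv> int_ring N \<Delta>"

lemma zero_in: "0 \<in> \<Delta>"
  using diff_in[OF one_in one_in] by simp

lemma minus_in: "x \<in> \<Delta> \<Longrightarrow> - x \<in> \<Delta>"
  using diff_in[OF zero_in] by simp

lemma add_in: "x \<in> \<Delta> \<Longrightarrow> y \<in> \<Delta> \<Longrightarrow> x + y \<in> \<Delta>"
  using diff_in[of x "- y"] minus_in by simp

lemma N_mult: "N (x * y) = N x * N y"
  and N_add: "N (x + y) \<le> max (N x) (N y)"
  and N_nonneg: "0 \<le> N x"
  and N_eq_0: "N x = 0 \<longleftrightarrow> x = 0"
  using nonarch by (auto simp: nonarch_abs_def)

lemma N_1: "N 1 = 1"
  using N_mult[of 1 1] N_eq_0[of 1] by simp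

lemma N_inverse: "N (inverse x) = inverse (N x)"
proof (cases "x = 0")
  case False
  then have "N x * N (inverse x) = 1"
    using N_mult[of x "inverse x"] N_1 by simp
  then show ?thesis
    by (simp add: inverse_unique)
qed (use N_eq_0[of 0] in simp)

lemma N_minus: "N (- x) = N x"
proof -
  have "(N (- 1))\<^sup>2 = 1"
    using N_mult[of "- 1" "- 1"] N_1 by (simp add: power2_eq_square)
  then have "N (- 1) = 1"
    using N_nonneg[of "- 1"] by (simp add: power2_eq_1_iff)
  then show ?thesis using N_mult[of "- 1" x] by simp
qed

lemma \<omega>: "\<omega> \<in> \<Delta>" "\<omega> \<noteq> 0" "N \<omega> < 1" "x \<in> \<Delta> \<Longrightarrow> N x < 1 \<Longrightarrow> N x \<le> N \<omega>"
  using uniformizer by (auto simp: uniformizer_def)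

lemma \<omega>_powi_in: "\<omega> powi i \<in> \<Delta>"
proof -
  have "x ^ n \<in> \<Delta>" if "x \<in> \<Delta>" for x n
    by (induction n) (auto intro: one_in mult_in that)
  then show ?thesis using \<omega>(1) inverse_in by (simp add: power_int_def)
qed

lemma \<O>_closed:
  "0 \<in> \<O>" "1 \<in> \<O>" "\<omega> \<in> \<O>" "x \<in> \<O> \<Longrightarrow> y \<in> \<O> \<Longrightarrow> x + y \<in> \<O>" "x \<in> \<O> \<Longrightarrow> y \<in> \<O> \<Longrightarrow> x * y \<in> \<O>"
  "x \<in> \<O> \<Longrightarrow> - x \<in> \<O>"
  using zero_in one_in add_in mult_in minus_in \<omega> N_mult N_add[of x y] N_minus N_1 N_eq_0[of 0]
  by (auto simp: int_ring_def mult_le_one N_nonneg)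

section \<open>Lattices, their bases and coordinate functionals\<close>

lemma right_span_closed:
  assumes "0 \<in> R" "\<And>x y. x \<in> R \<Longrightarrow> y \<in> R \<Longrightarrow> x + y \<in> R" "\<And>x y. x \<in> R \<Longrightarrow> y \<in> R \<Longrightarrow> x * y \<in> R"
  shows "0 \<in> right_span R B"
    and "x \<in> right_span R B \<Longrightarrow> y \<in> right_span R B \<Longrightarrow> x + y \<in> right_span R B"
    and "x \<in> right_span R B \<Longrightarrow> d \<in> R \<Longrightarrow> x * d \<in> right_span R B"
proof -
  show "0 \<in> right_span R B"
    unfolding right_span_def using assms by (intro CollectI exI[of _ "\<lambda>b. 0"]) auto
  assume "x \<in> right_span R B"
  then obtain c where c: "x = (\<Sum>b\<in>B. b * c b)" "\<forall>b\<in>B. c b \<in> R"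
    by (auto simp: right_span_def)
  show "x * d \<in> right_span R B" if "d \<in> R"
    unfolding right_span_def using c assms that
    by (intro CollectI exI[of _ "\<lambda>b. c b * d"]) (auto simp: sum_distrib_right mult.assoc)
  assume "y \<in> right_span R B"
  then obtain d where d: "y = (\<Sum>b\<in>B. b * d b)" "\<forall>b\<in>B. d b \<in> R"
    by (auto simp: right_span_def)
  show "x + y \<in> right_span R B"
    unfolding right_span_def using c d assms
    by (intro CollectI exI[of _ "\<lambda>b. c b + d b"]) (auto simp: sum.distrib distrib_left)
qed

lemma lattice_closed:
  assumes "lattice N \<Delta> L"
  shows "0 \<in> L" "x \<in> L \<Longrightarrow> y \<in> L \<Longrightarrow> x + y \<in> L" "x \<in> L \<Longrightarrow> d \<in> \<O> \<Longrightarrow> x * d \<in> L"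
    "x \<in> L \<Longrightarrow> - x \<in> L"
proof -
  obtain B where L: "L = right_span \<O> B" using assms by (auto simp: lattice_def)
  note * = right_span_closed[where R = \<O>, OF \<O>_closed(1) \<O>_closed(4) \<O>_closed(5)]
  show "0 \<in> L" "x \<in> L \<Longrightarrow> y \<in> L \<Longrightarrow> x + y \<in> L" and m: "\<And>d. x \<in> L \<Longrightarrow> d \<in> \<O> \<Longrightarrow> x * d \<in> L"
    unfolding L using * by blast+
  show "- x \<in> L" if "x \<in> L"
    using m[OF that \<O>_closed(6)[OF \<O>_closed(2)]] by simp
qed

text \<open>Substitute the expression of \<open>b0\<close> into a given combination; in the other
  direction, give \<open>b0\<close> the coefficient 0. The coefficient set \<open>R\<close> is left
  open because a redundant generator has to be dropped over \<O> and over \<Delta>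
  simultaneously.\<close>

lemma right_span_remove:
  assumes fin: "finite B" and b0: "b0 \<in> B"
    and R: "0 \<in> R" "\<And>x y. x \<in> R \<Longrightarrow> y \<in> R \<Longrightarrow> x + y \<in> R" "\<And>x y. x \<in> R \<Longrightarrow> y \<in> R \<Longrightarrow> x * y \<in> R"
    and d: "\<And>b. b \<in> B \<Longrightarrow> d b \<in> R" "b0 = (\<Sum>b\<in>B - {b0}. b * d b)"
  shows "right_span R (B - {b0}) = right_span R B"
proof (intro equalityI subsetI)
  fix x assume "x \<in> right_span R B"
  then obtain c where c: "x = (\<Sum>b\<in>B. b * c b)" "\<forall>b\<in>B. c b \<in> R"
    by (auto simp: right_span_def)
  have "x = b0 * c b0 + (\<Sum>b\<in>B - {b0}. b * c b)"
    unfolding c(1) by (rule sum.remove[OF fin b0])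
  also have "b0 * c b0 = (\<Sum>b\<in>B - {b0}. b * (d b * c b0))"
    by (subst d(2)) (simp add: sum_distrib_right mult.assoc)
  finally have "x = (\<Sum>b\<in>B - {b0}. b * (d b * c b0 + c b))"
    by (simp add: sum.distrib distrib_left)
  then show "x \<in> right_span R (B - {b0})"
    unfolding right_span_def using c(2) R d(1) b0
    by (intro CollectI exI[of _ "\<lambda>b. d b * c b0 + c b"]) auto
next
  fix x assume "x \<in> right_span R (B - {b0})"
  then obtain c where c: "x = (\<Sum>b\<in>B - {b0}. b * c b)" "\<forall>b\<in>B - {b0}. c b \<in> R"
    by (auto simp: right_span_def)
  let ?c = "c(b0 := 0)"
  have "(\<Sum>b\<in>B. b * ?c b) = x"
    unfolding c(1) by (subst sum.remove[OF fin b0]) (auto intro: sum.cong)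
  then show "x \<in> right_span R B"
    unfolding right_span_def using c(2) R(1) by (intro CollectI exI[of _ ?c]) auto
qed

text \<open>A minimal generating set is free: in a linear relation, divide by a coefficient of maximal
  absolute value.\<close>

lemma lattice_basis:
  assumes "lattice N \<Delta> L"
  obtains B where "finite B" "L = right_span \<O> B" "right_span \<Delta> B = UNIV"
    "\<And>c. (\<forall>b\<in>B. c b \<in> \<Delta>) \<Longrightarrow> (\<Sum>b\<in>B. b * c b) = 0 \<Longrightarrow> \<forall>b\<in>B. c b = 0"
proof -
  let ?P = "\<lambda>B. finite B \<and> L = right_span \<O> B \<and> right_span \<Delta> B = UNIV"
  obtain B0 where B0: "?P B0" using assms unfolding lattice_def by (rule exE)
  have "\<exists>B. ?P B \<and> (\<forall>B'. ?P B' \<longrightarrow> card B \<le> card B')"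
    using B0 by (rule ex_has_least_nat)
  then obtain B where "?P B \<and> (\<forall>B'. ?P B' \<longrightarrow> card B \<le> card B')" by (rule exE)
  then have B: "?P B" and min: "\<And>B'. ?P B' \<Longrightarrow> card B \<le> card B'" by simp_all
  have free: "\<forall>b\<in>B. c b = 0" if c: "\<forall>b\<in>B. c b \<in> \<Delta>" "(\<Sum>b\<in>B. b * c b) = 0" for c
  proof (rule ccontr)
    assume "\<not> ?thesis"
    then obtain b1 where b1: "b1 \<in> B" "c b1 \<noteq> 0" by blast
    obtain b0 where b0: "b0 \<in> B" and max: "\<And>b. b \<in> B \<Longrightarrow> N (c b) \<le> N (c b0)"
    proof -
      have f: "finite ((\<lambda>b. N (c b)) ` B)" and ne: "(\<lambda>b. N (c b)) ` B \<noteq> {}"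
        using B b1(1) by auto
      obtain b0 where "b0 \<in> B" "N (c b0) = Max ((\<lambda>b. N (c b)) ` B)"
        using Max_in[OF f ne] by auto
      then show ?thesis using Max_ge[OF f] that by auto
    qed
    have nz: "c b0 \<noteq> 0"
      using max[OF b1(1)] b1(2) N_nonneg[of "c b1"] N_eq_0[of "c b1"] N_eq_0[of "c b0"] by auto
    then have pos: "0 < N (c b0)" using N_nonneg[of "c b0"] N_eq_0[of "c b0"] by linarith
    \<comment> \<open>The relation solved for \<open>b0\<close>. The division is on the right, where
      the coefficients stand, and maximality of \<open>N (c b0)\<close> puts the quotients into
      \<O>.\<close>
    define d where "d = (\<lambda>b. - (c b * inverse (c b0)))"
    have dO: "d b \<in> \<O>" if "b \<in> B" for b
    proof -
      have "N (c b) * inverse (N (c b0)) \<le> 1"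
        using max[OF that] pos by (simp add: field_simps)
      then show ?thesis
        using that c(1) b0 by (simp add: d_def int_ring_def N_minus N_mult N_inverse minus_in mult_in inverse_in)
    qed
    then have d\<Delta>: "d b \<in> \<Delta>" if "b \<in> B" for b using that by (auto simp: int_ring_def)
    have "b0 * c b0 + (\<Sum>b\<in>B - {b0}. b * c b) = 0"
      using c(2) sum.remove[of B b0 "\<lambda>b. b * c b"] B b0 by simp
    then have "b0 * c b0 = - (\<Sum>b\<in>B - {b0}. b * c b)"
      by (simp add: eq_neg_iff_add_eq_0)
    then have "b0 * c b0 * inverse (c b0) = - (\<Sum>b\<in>B - {b0}. b * c b) * inverse (c b0)"
      by simp
    then have rel: "b0 = (\<Sum>b\<in>B - {b0}. b * d b)"
      using nz by (simp add: mult.assoc d_def sum_distrib_right sum_negf)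
    have fin: "finite B" using B by blast
    have "right_span \<O> (B - {b0}) = right_span \<O> B"
      using \<O>_closed dO by (intro right_span_remove[OF fin b0 _ _ _ _ rel]) auto
    moreover have "right_span \<Delta> (B - {b0}) = right_span \<Delta> B"
      using zero_in add_in mult_in d\<Delta> by (intro right_span_remove[OF fin b0 _ _ _ _ rel]) auto
    ultimately have "?P (B - {b0})" using B by auto
    then have "card B \<le> card (B - {b0})" by (rule min)
    then show False using card_Diff1_less[OF fin b0] by simp
  qed
  show ?thesis using B free by (intro that[of B]) simp_all
qed

text \<open>Since \<open>z\<close> is not divisible by \<omega> in \<open>L\<close>, one of its
  coordinates in a basis is a unit of \<O>. That coordinate is the functional, up to left
  multiplication by the inverse unit, which preserves right linearity and integrality.\<close>

lemma lattice_functional: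
  assumes L: "lattice N \<Delta> L" and z: "z \<in> L" "z \<notin> (\<lambda>x. x * \<omega>) ` L"
  obtains \<psi> where "\<And>x y. \<psi> (x + y) = \<psi> x + \<psi> y" "\<And>x d. d \<in> \<Delta> \<Longrightarrow> \<psi> (x * d) = \<psi> x * d"
    "\<psi> z = 1" "\<And>x. x \<in> L \<Longrightarrow> \<psi> x \<in> \<O>"
proof -
  obtain B where B: "finite B" "L = right_span \<O> B" "right_span \<Delta> B = UNIV"
    and free: "\<And>c. (\<forall>b\<in>B. c b \<in> \<Delta>) \<Longrightarrow> (\<Sum>b\<in>B. b * c b) = 0 \<Longrightarrow> \<forall>b\<in>B. c b = 0"
    using lattice_basis[OF L] by blast
  have "\<forall>x. \<exists>c. (\<forall>b\<in>B. c b \<in> \<Delta>) \<and> x = (\<Sum>b\<in>B. b * c b)"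
    using B(3) unfolding right_span_def by blast
  then obtain k where k: "\<And>x b. b \<in> B \<Longrightarrow> k x b \<in> \<Delta>" "\<And>x. x = (\<Sum>b\<in>B. b * k x b)"
    by metis
  \<comment> \<open>The coordinates \<open>k\<close> come from a mere choice; freeness of the basis
    makes them unique, and linearity follows.\<close>
  have uniq: "k x b = c b" if "\<forall>b\<in>B. c b \<in> \<Delta>" "x = (\<Sum>b\<in>B. b * c b)" "b \<in> B" for x c b
  proof -
    have "(\<Sum>b\<in>B. b * (k x b - c b)) = 0"
      using k(2)[of x] that(2) by (simp add: right_diff_distrib sum_subtractf)
    then have "\<forall>b\<in>B. k x b - c b = 0"
      using that(1) k(1) diff_in by (intro free) auto
    then show ?thesis using that(3) by simp
  qed
  have k_add: "k (x + y) b = k x b + k y b" if "b \<in> B" for x y b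
  proof (rule uniq[OF _ _ that])
    show "x + y = (\<Sum>b\<in>B. b * (k x b + k y b))"
      using k(2)[of x] k(2)[of y] by (simp add: distrib_left sum.distrib)
  qed (use k add_in in auto)
  have k_mult: "k (x * d) b = k x b * d" if "b \<in> B" "d \<in> \<Delta>" for x d b
  proof (rule uniq[OF _ _ that(1)])
    have "x * d = (\<Sum>b\<in>B. b * k x b) * d" using k(2)[of x] by simp
    then show "x * d = (\<Sum>b\<in>B. b * (k x b * d))"
      by (simp add: sum_distrib_right mult.assoc)
  qed (use k mult_in that in auto)
  \<comment> \<open>A point of \<open>L\<close> has coefficients in \<O> by definition, and by
    uniqueness these are its coordinates over \<Delta>.\<close>
  have kO: "k x b \<in> \<O>" if "x \<in> L" "b \<in> B" for x b
  proof -
    obtain c where c: "x = (\<Sum>b\<in>B. b * c b)" "\<forall>b\<in>B. c b \<in> \<O>"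
      using \<open>x \<in> L\<close> B(2) unfolding right_span_def by blast
    then have "k x b = c b" using that(2) by (intro uniq) (auto simp: int_ring_def)
    then show ?thesis using c that(2) by simp
  qed
  \<comment> \<open>Otherwise every coordinate has absolute value below 1, hence at most
    \<open>N \<omega>\<close>, and dividing all of them by \<omega> on the right exhibits
    \<open>z\<close> as an element of \<open>L \<omega>\<close>.\<close>
  have "\<exists>b\<in>B. N (k z b) = 1"
  proof (rule ccontr)
    assume "\<not> ?thesis"
    then have lt: "N (k z b) \<le> N \<omega>" if "b \<in> B" for b
      using kO[OF z(1) that] that by (intro \<omega>(4)) (auto simp: int_ring_def less_le)
    have "0 < N \<omega>" using \<omega>(2) N_nonneg[of \<omega>] N_eq_0[of \<omega>] by linarith
    then have "N (k z b) * inverse (N \<omega>) \<le> 1" if "b \<in> B" for b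
      using lt[OF that] by (simp add: field_simps)
    then have "k z b * inverse \<omega> \<in> \<O>" if "b \<in> B" for b
      unfolding int_ring_def using that mult_in[OF k(1)[OF that] inverse_in[OF \<omega>(1)]]
      by (simp add: N_mult N_inverse)
    then have "(\<Sum>b\<in>B. b * (k z b * inverse \<omega>)) \<in> L"
      unfolding B(2) right_span_def by (intro CollectI exI[of _ "\<lambda>b. k z b * inverse \<omega>"]) simp
    moreover have "z = (\<Sum>b\<in>B. b * (k z b * inverse \<omega>)) * \<omega>"
      using k(2)[of z] \<omega>(2) by (simp add: sum_distrib_right mult.assoc)
    ultimately have "z \<in> (\<lambda>x. x * \<omega>) ` L" by (intro image_eqI)
    then show False using z(2) by contradiction
  qed
  then obtain b where b: "b \<in> B" "N (k z b) = 1" by blast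
  have nz: "k z b \<noteq> 0" using b(2) N_eq_0[of "k z b"] by auto
  have "inverse (k z b) \<in> \<O>" using b k(1) inverse_in by (simp add: int_ring_def N_inverse)
  then show ?thesis
    using k_add k_mult kO b(1) nz \<O>_closed(5)
    by (intro that[of "\<lambda>x. inverse (k z b) * k x b"]) (auto simp: distrib_left mult.assoc)
qed

section \<open>Vertices and adjacency\<close>

lemma vertex_memE:
  assumes "s \<in> vertices N \<Delta> \<omega>" "M \<in> s"
  obtains L i where "lattice N \<Delta> L" "s = lattice_class \<omega> L" "M = (\<lambda>x. x * \<omega> powi i) ` L"
  using assms by (auto simp: vertices_def lattice_class_def)

lemma image_powi_powi:
  "(\<lambda>x. x * \<omega> powi i) ` (\<lambda>x. x * \<omega> powi j) ` L = (\<lambda>x. x * \<omega> powi (j + i)) ` L"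
  using \<omega>(2) by (simp add: image_image mult.assoc power_int_add)

lemma vertex_mem_shift:
  assumes "s \<in> vertices N \<Delta> \<omega>" "M \<in> s"
  shows "(\<lambda>x. x * \<omega> powi i) ` M \<in> s"
proof -
  obtain L j where "s = lattice_class \<omega> L" "M = (\<lambda>x. x * \<omega> powi j) ` L"
    using vertex_memE[OF assms] by metis
  then show ?thesis by (auto simp: lattice_class_def image_powi_powi)
qed

lemma vertex_mem_eq_shift:
  assumes "s \<in> vertices N \<Delta> \<omega>" "M \<in> s" "M' \<in> s"
  obtains i where "M' = (\<lambda>x. x * \<omega> powi i) ` M"
proof -
  obtain L j where s: "s = lattice_class \<omega> L" and M: "M = (\<lambda>x. x * \<omega> powi j) ` L"
    using vertex_memE[OF assms(1,2)] by metis
  obtain j' where "M' = (\<lambda>x. x * \<omega> powi j') ` L"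
    using assms(3) s by (auto simp: lattice_class_def)
  then have "M' = (\<lambda>x. x * \<omega> powi (j' - j)) ` M"
    by (simp add: M image_powi_powi)
  then show ?thesis by (rule that)
qed

text \<open>Transported from a lattice \<open>L\<close> with \<open>M = L \<omega> powi i\<close>;
  stability under \<omega> survives because \<omega> commutes with its own powers.\<close>

lemma vertex_mem_closed:
  assumes "s \<in> vertices N \<Delta> \<omega>" "M \<in> s"
  shows "x \<in> M \<Longrightarrow> y \<in> M \<Longrightarrow> x + y \<in> M" "x \<in> M \<Longrightarrow> - x \<in> M" "0 \<in> M" "x \<in> M \<Longrightarrow> x * \<omega> \<in> M"
proof -
  obtain L i where L: "lattice N \<Delta> L" and M: "M = (\<lambda>x. x * \<omega> powi i) ` L"
    using vertex_memE[OF assms] by metis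
  note C = lattice_closed[OF L]
  show "0 \<in> M" using C(1) by (auto simp: M image_iff intro!: bexI[of _ 0])
  assume "x \<in> M"
  then obtain x' where x: "x' \<in> L" "x = x' * \<omega> powi i" by (auto simp: M)
  show "- x \<in> M"
    using C(4)[OF x(1)] by (auto simp: M x(2) image_iff intro!: bexI[of _ "- x'"])
  have "x * \<omega> = (x' * \<omega>) * \<omega> powi i"
    by (simp add: x(2) mult.assoc power_int_commutes)
  then show "x * \<omega> \<in> M"
    using C(3)[OF x(1) \<O>_closed(3)] by (auto simp: M)
  assume "y \<in> M"
  then obtain y' where y: "y' \<in> L" "y = y' * \<omega> powi i" by (auto simp: M)
  have "x + y = (x' + y') * \<omega> powi i" by (simp add: x y distrib_right)
  then show "x + y \<in> M"
    using C(2)[OF x(1) y(1)] by (auto simp: M)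
qed

text \<open>Shift the larger lattice: \<open>L \<supset> L' \<supset> L \<omega>\<close> continues
  as \<open>L' \<supset> L \<omega> \<supset> L' \<omega>\<close>.\<close>

lemma adjacent_sym:
  assumes "adjacent N \<Delta> \<omega> s t"
  shows "adjacent N \<Delta> \<omega> t s"
proof -
  obtain L L' where st: "s \<in> vertices N \<Delta> \<omega>" "t \<in> vertices N \<Delta> \<omega>"
    and L: "L \<in> s" "L' \<in> t" "L' \<subset> L" "(\<lambda>x. x * \<omega>) ` L \<subset> L'"
    using assms by (auto simp: adjacent_def)
  have "(\<lambda>x. x * \<omega>) ` L \<in> s"
    using vertex_mem_shift[OF st(1) L(1), of 1] by simp
  moreover have "inj (\<lambda>x. x * \<omega>)" using \<omega>(2) by (simp add: inj_on_def)
  then have "(\<lambda>x. x * \<omega>) ` L' \<subset> (\<lambda>x. x * \<omega>) ` L"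
    using L(3) by (simp add: inj_image_subset_iff psubset_eq inj_image_eq_iff)
  ultimately show ?thesis
    unfolding adjacent_def using st L by (intro conjI bexI[of _ L'] bexI[of _ "(\<lambda>x. x * \<omega>) ` L"])
qed

section \<open>Endomorphisms and hereditary orders\<close>

lemma End_ring_memD:
  assumes "f \<in> carrier (End_ring \<Delta>)"
  shows "f (x + y) = f x + f y" "d \<in> \<Delta> \<Longrightarrow> f (x * d) = f x * d" "f 0 = 0" "f (- x) = - f x"
    "f (x - y) = f x - f y"
proof -
  show a: "\<And>x y. f (x + y) = f x + f y" and "d \<in> \<Delta> \<Longrightarrow> f (x * d) = f x * d"
    using assms by (auto simp: End_ring_def)
  show z: "f 0 = 0" using a[of 0 0] by simp
  show m: "\<And>x. f (- x) = - f x" using a[of _ "- _"] z by (metis add.right_inverse minus_unique)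
  show "f (x - y) = f x - f y" using a[of x "- y"] m by simp
qed

text \<open>The powers of \<omega> lie in \<Delta>, so right multiplication by them commutes with
  \<open>f\<close>. Membership in an order can therefore be tested on one lattice per
  vertex.\<close>

lemma stable_class:
  assumes f: "f \<in> carrier (End_ring \<Delta>)" and s: "s \<in> vertices N \<Delta> \<omega>" "L \<in> s" "M \<in> s"
    and L: "f ` L \<subseteq> L"
  shows "f ` M \<subseteq> M"
proof -
  obtain i where "M = (\<lambda>x. x * \<omega> powi i) ` L" using vertex_mem_eq_shift[OF s] by blast
  then show ?thesis using L End_ring_memD(2)[OF f \<omega>_powi_in] by auto
qed

lemma carrier_hereditary_order:
  "a \<in> carrier (hereditary_order \<Delta> \<sigma>) \<longleftrightarrow>
     a \<in> carrier (End_ring \<Delta>) \<and> (\<forall>s\<in>\<sigma>. \<forall>L\<in>s. a ` L \<subseteq> L)"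
  by (simp add: hereditary_order_def)

lemma End_ring_simps:
  "f \<otimes>\<^bsub>End_ring \<Delta>\<^esub> g = f \<circ> g" "\<one>\<^bsub>End_ring \<Delta>\<^esub> = id" "\<zero>\<^bsub>End_ring \<Delta>\<^esub> = (\<lambda>x. 0)"
  "f \<oplus>\<^bsub>End_ring \<Delta>\<^esub> g = (\<lambda>x. f x + g x)"
  by (simp_all add: End_ring_def)

lemma hereditary_order_simps:
  "f \<otimes>\<^bsub>hereditary_order \<Delta> \<sigma>\<^esub> g = f \<circ> g" "\<one>\<^bsub>hereditary_order \<Delta> \<sigma>\<^esub> = id"
  "\<zero>\<^bsub>hereditary_order \<Delta> \<sigma>\<^esub> = (\<lambda>x. 0)" "f \<oplus>\<^bsub>hereditary_order \<Delta> \<sigma>\<^esub> g = (\<lambda>x. f x + g x)"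
  by (simp_all add: hereditary_order_def End_ring_def)

lemma End_ring_closed:
  "id \<in> carrier (End_ring \<Delta>)"
  "f \<in> carrier (End_ring \<Delta>) \<Longrightarrow> (\<lambda>x. - f x) \<in> carrier (End_ring \<Delta>)"
  "f \<in> carrier (End_ring \<Delta>) \<Longrightarrow> g \<in> carrier (End_ring \<Delta>) \<Longrightarrow> (\<lambda>x. f x + g x) \<in> carrier (End_ring \<Delta>)"
  "f \<in> carrier (End_ring \<Delta>) \<Longrightarrow> g \<in> carrier (End_ring \<Delta>) \<Longrightarrow> f \<circ> g \<in> carrier (End_ring \<Delta>)"
  by (auto simp: End_ring_def algebra_simps)

lemma a_inv_End_ring:
  assumes "f \<in> carrier (End_ring \<Delta>)"
  shows "\<ominus>\<^bsub>End_ring \<Delta>\<^esub> f = (\<lambda>x. - f x)"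
proof -
  interpret ring "End_ring \<Delta>" by (rule End_ring_ring)
  show ?thesis
    using assms End_ring_closed(2) by (intro minus_equality) (auto simp: End_ring_simps)
qed

lemma subring_hereditary_order:
  assumes \<sigma>: "\<sigma> \<subseteq> vertices N \<Delta> \<omega>"
  shows "subring (carrier (hereditary_order \<Delta> \<sigma>)) (End_ring \<Delta>)"
proof (rule ring.subringI[OF End_ring_ring])
  note closed = vertex_mem_closed[OF subsetD[OF \<sigma>]]
  show "carrier (hereditary_order \<Delta> \<sigma>) \<subseteq> carrier (End_ring \<Delta>)"
    by (auto simp: carrier_hereditary_order)
  show "\<one>\<^bsub>End_ring \<Delta>\<^esub> \<in> carrier (hereditary_order \<Delta> \<sigma>)"
    by (auto simp: carrier_hereditary_order End_ring_simps End_ring_closed)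
  fix f assume f: "f \<in> carrier (hereditary_order \<Delta> \<sigma>)"
  then show "\<ominus>\<^bsub>End_ring \<Delta>\<^esub> f \<in> carrier (hereditary_order \<Delta> \<sigma>)"
    using closed(2) by (auto simp: carrier_hereditary_order a_inv_End_ring End_ring_closed image_subset_iff)
  fix g assume g: "g \<in> carrier (hereditary_order \<Delta> \<sigma>)"
  show "f \<otimes>\<^bsub>End_ring \<Delta>\<^esub> g \<in> carrier (hereditary_order \<Delta> \<sigma>)"
    using f g by (simp add: carrier_hereditary_order End_ring_simps End_ring_closed image_subset_iff)
  show "f \<oplus>\<^bsub>End_ring \<Delta>\<^esub> g \<in> carrier (hereditary_order \<Delta> \<sigma>)"
    using f g closed(1) by (simp add: carrier_hereditary_order End_ring_simps End_ring_closed image_subset_iff)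
qed

lemma ring_hereditary_order:
  assumes "\<sigma> \<subseteq> vertices N \<Delta> \<omega>"
  shows "ring (hereditary_order \<Delta> \<sigma>)"
  using ring.subring_is_ring[OF End_ring_ring subring_hereditary_order[OF assms]]
  by (simp add: hereditary_order_def)

text \<open>The left-inverse criterion with the ring operations of the order written out as
  operations on maps; all later arguments about radicals start from this form.\<close>

lemma jacobson_radical_hereditary_order:
  assumes \<sigma>: "\<sigma> \<subseteq> vertices N \<Delta> \<omega>"
  shows "p \<in> jacobson_radical (hereditary_order \<Delta> \<sigma>) \<longleftrightarrow>
     p \<in> carrier (hereditary_order \<Delta> \<sigma>) \<and>
     (\<forall>r\<in>carrier (hereditary_order \<Delta> \<sigma>). \<exists>u\<in>carrier (hereditary_order \<Delta> \<sigma>). \<forall>x. u (x - r (p x)) = x)"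
proof -
  interpret ring "hereditary_order \<Delta> \<sigma>" by (rule ring_hereditary_order[OF \<sigma>])
  \<comment> \<open>The additive inverse is defined relative to the carrier, so its value in
    \<open>End_ring \<Delta>\<close> does not transfer by simplification and is computed
    anew.\<close>
  have inv: "\<ominus>\<^bsub>hereditary_order \<Delta> \<sigma>\<^esub> f = (\<lambda>x. - f x)" if "f \<in> carrier (hereditary_order \<Delta> \<sigma>)" for f
  proof (rule minus_equality)
    show "(\<lambda>x. - f x) \<in> carrier (hereditary_order \<Delta> \<sigma>)"
      using that subringE(5)[OF subring_hereditary_order[OF \<sigma>] that] a_inv_End_ring[of f]
      by (auto simp: carrier_hereditary_order)
  qed (use that in \<open>auto simp: hereditary_order_simps\<close>)
  have "u \<otimes>\<^bsub>hereditary_order \<Delta> \<sigma>\<^esub> (\<one>\<^bsub>hereditary_order \<Delta> \<sigma>\<^esub> \<ominus>\<^bsub>hereditary_order \<Delta> \<sigma>\<^esub> r \<otimes>\<^bsub>hereditary_order \<Delta> \<sigma>\<^esub> p)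
        = \<one>\<^bsub>hereditary_order \<Delta> \<sigma>\<^esub> \<longleftrightarrow> (\<forall>x. u (x - r (p x)) = x)"
    if "r \<in> carrier (hereditary_order \<Delta> \<sigma>)" "p \<in> carrier (hereditary_order \<Delta> \<sigma>)" for u r
    using inv[OF m_closed[OF that]]
    by (auto simp: minus_eq hereditary_order_simps fun_eq_iff)
  then show ?thesis by (simp add: jacobson_radical_iff cong: conj_cong)
qed

section \<open>The radicals attached to vertices and edges\<close>

lemma jacobson_radicalE:
  assumes "\<sigma> \<subseteq> vertices N \<Delta> \<omega>" "p \<in> jacobson_radical (hereditary_order \<Delta> \<sigma>)"
    and "r \<in> carrier (hereditary_order \<Delta> \<sigma>)"
  obtains u where "u \<in> carrier (hereditary_order \<Delta> \<sigma>)" "\<And>x. u (x - r (p x)) = x"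
  using assms(2,3) unfolding jacobson_radical_hereditary_order[OF assms(1)] by auto

text \<open>One inclusion in the description of the radical as the endomorphisms sending
  \<open>L\<close> into \<open>L \<omega>\<close>. If \<open>p y\<close> were outside
  \<open>L \<omega>\<close>, a functional with value 1 at \<open>p y\<close> would give an
  \<open>r\<close> in the order for which \<open>1 - r p\<close> is not injective.\<close>

lemma jacobson_radical_vertex:
  assumes s: "s \<in> vertices N \<Delta> \<omega>" and p: "p \<in> jacobson_radical (hereditary_order \<Delta> {s})"
    and M: "M \<in> s"
  shows "p ` M \<subseteq> (\<lambda>x. x * \<omega>) ` M"
proof -
  obtain L i where L: "lattice N \<Delta> L" "s = lattice_class \<omega> L" and M_eq: "M = (\<lambda>x. x * \<omega> powi i) ` L"
    using vertex_memE[OF s M] by metis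
  have "L = (\<lambda>x. x * \<omega> powi 0) ` L" by simp
  then have Ls: "L \<in> s" unfolding L(2) lattice_class_def by blast
  have sub: "{s} \<subseteq> vertices N \<Delta> \<omega>" using s by simp
  note J = jacobson_radical_hereditary_order[OF sub]
  have pA: "p \<in> carrier (hereditary_order \<Delta> {s})" using p J by blast
  then have pE: "p \<in> carrier (End_ring \<Delta>)" and pL: "p ` L \<subseteq> L"
    using Ls by (auto simp: carrier_hereditary_order)
  have *: "p y \<in> (\<lambda>x. x * \<omega>) ` L" if y: "y \<in> L" for y
  proof (rule ccontr)
    assume not: "p y \<notin> (\<lambda>x. x * \<omega>) ` L"
    have "p y \<in> L" using pL y by blast
    then obtain \<psi> where l: "\<And>x y. \<psi> (x + y) = \<psi> x + \<psi> y" "\<And>x d. d \<in> \<Delta> \<Longrightarrow> \<psi> (x * d) = \<psi> x * d"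
      "\<psi> (p y) = 1" "\<And>x. x \<in> L \<Longrightarrow> \<psi> x \<in> \<O>"
      using lattice_functional[OF L(1) _ not] by blast
    \<comment> \<open>\<open>r\<close> lies in the order and \<open>r (p y) = y\<close>, so \<open>1 - r p\<close> kills \<open>y\<close>\<close>
    define r where "r = (\<lambda>x. y * \<psi> x)"
    have rE: "r \<in> carrier (End_ring \<Delta>)"
      by (simp add: End_ring_def r_def l(1,2) distrib_left mult.assoc)
    have "r ` L \<subseteq> L" using lattice_closed(3)[OF L(1) y] l(4) by (auto simp: r_def)
    then have "r \<in> carrier (hereditary_order \<Delta> {s})"
      using stable_class[OF rE s Ls] rE by (simp add: carrier_hereditary_order)
    then obtain u where u: "u \<in> carrier (hereditary_order \<Delta> {s})" "\<And>x. u (x - r (p x)) = x"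
      by (rule jacobson_radicalE[OF sub p]) auto
    \<comment> \<open>Here \<open>0 = y - r (p y)\<close>. Hence \<open>y = 0\<close>, so
      \<open>p y = 0\<close>, which does lie in \<open>L \<omega>\<close>.\<close>
    have "u 0 = y" using u(2)[of y] by (simp add: r_def l(3))
    moreover have "u 0 = 0" using u(1) End_ring_memD(3) by (simp add: carrier_hereditary_order)
    ultimately have "p y = 0" using End_ring_memD(3)[OF pE] by simp
    then show False using not lattice_closed(1)[OF L(1)] by (auto simp: image_iff)
  qed
  show ?thesis
  proof
    fix m assume "m \<in> p ` M"
    then obtain y where y: "y \<in> L" "m = p (y * \<omega> powi i)" by (auto simp: M_eq)
    obtain x where x: "x \<in> L" "p y = x * \<omega>" using *[OF y(1)] by blast
    have "m = (x * \<omega> powi i) * \<omega>"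
      using y x End_ring_memD(2)[OF pE \<omega>_powi_in] by (simp add: mult.assoc power_int_commutes)
    then show "m \<in> (\<lambda>x. x * \<omega>) ` M" using x by (auto simp: M_eq)
  qed
qed

text \<open>The inclusion is opposite to that of the orders: the edge order lies in the order of
  \<open>s\<close>, but its radical is the larger one.\<close>

lemma jacobson_radical_vertex_subset_edge:
  assumes adj: "adjacent N \<Delta> \<omega> s t"
  shows "jacobson_radical (hereditary_order \<Delta> {s}) \<subseteq> jacobson_radical (hereditary_order \<Delta> {s, t})"
proof
  fix p assume p: "p \<in> jacobson_radical (hereditary_order \<Delta> {s})"
  obtain L L' where st: "s \<in> vertices N \<Delta> \<omega>" "t \<in> vertices N \<Delta> \<omega>"
    and L: "L \<in> s" "L' \<in> t" "L' \<subset> L" "(\<lambda>x. x * \<omega>) ` L \<subset> L'"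
    using adj by (auto simp: adjacent_def)
  have sub: "{s} \<subseteq> vertices N \<Delta> \<omega>" "{s, t} \<subseteq> vertices N \<Delta> \<omega>" using st by auto
  note Js = jacobson_radical_hereditary_order[OF sub(1)]
  have pA: "p \<in> carrier (hereditary_order \<Delta> {s})" using p Js by blast
  have pL: "p x \<in> L'" if "x \<in> L" for x
    using jacobson_radical_vertex[OF st(1) p L(1)] L(4) that by blast
  have edge: "a \<in> carrier (hereditary_order \<Delta> {s, t})"
    \<comment> \<open>For an element of the order of \<open>s\<close>, the single lattice
      \<open>L'\<close> decides membership in the edge order.\<close>
    if a: "a \<in> carrier (hereditary_order \<Delta> {s})" "\<And>x. x \<in> L' \<Longrightarrow> a x \<in> L'" for a
  proof -
    have aE: "a \<in> carrier (End_ring \<Delta>)" using a(1) by (simp add: carrier_hereditary_order)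
    have "a ` L' \<subseteq> L'" using a(2) by blast
    then show ?thesis
      using a(1) stable_class[OF aE st(2) L(2)] by (simp add: carrier_hereditary_order)
  qed
  have pA': "p \<in> carrier (hereditary_order \<Delta> {s, t})"
    using edge[OF pA] pL L(3) by blast
  have "\<exists>u\<in>carrier (hereditary_order \<Delta> {s, t}). \<forall>x. u (x - r (p x)) = x"
    if r: "r \<in> carrier (hereditary_order \<Delta> {s, t})" for r
  proof -
    \<comment> \<open>The left inverse is first found in the larger order of \<open>s\<close>, where
      \<open>p\<close> is known to be radical, and then shown to lie in the edge order.\<close>
    have "r \<in> carrier (hereditary_order \<Delta> {s})" using r by (simp add: carrier_hereditary_order)
    then obtain u where u: "u \<in> carrier (hereditary_order \<Delta> {s})" "\<And>x. u (x - r (p x)) = x"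
      by (rule jacobson_radicalE[OF sub(1) p]) auto
    have uE: "u \<in> carrier (End_ring \<Delta>)" and uL: "\<And>x. x \<in> L \<Longrightarrow> u x \<in> L"
      using u(1) r L(1,2) by (auto simp: carrier_hereditary_order)
    \<comment> \<open>\<open>u = 1 + u r p\<close> and \<open>u r p L \<subseteq> L \<omega> \<subseteq> L'\<close>, so \<open>u\<close> stabilizes \<open>L'\<close>\<close>
    have inv: "u x = u (r (p x)) + x" for x
      using u(2)[of x] End_ring_memD(5)[OF uE] by (simp add: algebra_simps)
    have rp: "\<exists>y\<in>L. r (p x) = y * \<omega>" if "x \<in> L" for x
    proof -
      have "p x \<in> (\<lambda>x. x * \<omega>) ` L"
        using jacobson_radical_vertex[OF st(1) p L(1)] that by (simp add: image_subset_iff)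
      then obtain y where y: "p x = y * \<omega>" "y \<in> L" by (rule imageE)
      have "r (p x) = r y * \<omega>"
        using y r End_ring_memD(2)[OF _ \<omega>(1)] by (simp add: carrier_hereditary_order)
      moreover have "r y \<in> L" using y r L(1) by (auto simp: carrier_hereditary_order)
      ultimately show ?thesis by blast
    qed
    have "u x \<in> L'" if "x \<in> L'" for x
    proof -
      have "x \<in> L" using that L(3) by auto
      from rp[OF this] obtain y where y: "y \<in> L" "r (p x) = y * \<omega>" by (rule bexE)
      then have "u (r (p x)) = u y * \<omega>" using End_ring_memD(2)[OF uE \<omega>(1)] by simp
      then have "u (r (p x)) \<in> L'" using uL[OF y(1)] L(4) by auto
      then show ?thesis using inv[of x] vertex_mem_closed(1)[OF st(2) L(2)] that by simp
    qed
    then have "u \<in> carrier (hereditary_order \<Delta> {s, t})" by (rule edge[OF u(1)])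
    then show ?thesis using u(2) by (intro bexI) simp_all
  qed
  then show "p \<in> jacobson_radical (hereditary_order \<Delta> {s, t})"
    unfolding jacobson_radical_hereditary_order[OF sub(2)] using pA' by simp
qed

text \<open>The criterion with \<open>r = - 1\<close> gives a left inverse \<open>u\<close> of
  \<open>g = 1 + p\<close>. Then \<open>u = 1 - u p\<close>, so the criterion with
  \<open>r = u\<close> gives a left inverse \<open>w\<close> of \<open>u\<close>; having
  \<open>g\<close> on its right and \<open>w\<close> on its left as inverses, \<open>u\<close> is
  invertible with inverse \<open>g\<close>. The representation is only controlled on
  \<open>GL \<Delta>\<close>, which is why invertibility matters.\<close>

lemma U1_subset_GL:
  assumes \<sigma>: "\<sigma> \<subseteq> vertices N \<Delta> \<omega>"
  shows "U1 \<Delta> \<sigma> \<subseteq> carrier (GL \<Delta>)"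
proof
  note J = jacobson_radical_hereditary_order[OF \<sigma>]
  fix g assume "g \<in> U1 \<Delta> \<sigma>"
  then obtain p where g: "g = (\<lambda>x. x + p x)" and p: "p \<in> jacobson_radical (hereditary_order \<Delta> \<sigma>)"
    by (auto simp: U1_def)
  have pA: "p \<in> carrier (hereditary_order \<Delta> \<sigma>)" using p J by blast
  then have pE: "p \<in> carrier (End_ring \<Delta>)" by (simp add: carrier_hereditary_order)
  have "(\<lambda>x. - x) \<in> carrier (End_ring \<Delta>)" by (simp add: End_ring_def)
  then have m: "(\<lambda>x. - x) \<in> carrier (hereditary_order \<Delta> \<sigma>)"
    using vertex_mem_closed(2)[OF subsetD[OF \<sigma>]] by (auto simp: carrier_hereditary_order)
  then obtain u where uA: "u \<in> carrier (hereditary_order \<Delta> \<sigma>)"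
    and left_inv: "\<And>x. u (x - - p x) = x"
    by (rule jacobson_radicalE[OF \<sigma> p]) auto
  have ug: "u (g x) = x" for x using left_inv[of x] by (simp add: g)
  have uE: "u \<in> carrier (End_ring \<Delta>)" using uA by (simp add: carrier_hereditary_order)
  from uA obtain w where w: "\<And>x. w (x - u (p x)) = x"
    by (rule jacobson_radicalE[OF \<sigma> p]) auto
  have ux: "u x = x - u (p x)" for x
    using ug[of x] End_ring_memD(1)[OF uE] by (simp add: g algebra_simps)
  have wu: "w (u x) = x" for x using w[of x] ux[of x] by simp
  have "g (u x) = x" for x using wu[of "g (u x)"] wu[of x] ug[of "u x"] by simp
  moreover have gE: "g \<in> carrier (End_ring \<Delta>)"
    using pE by (auto simp: g End_ring_def algebra_simps)
  ultimately have "g \<in> Units (End_ring \<Delta>)"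
    unfolding Units_def using ug uE
    by (auto simp: End_ring_simps fun_eq_iff intro!: bexI[of _ u])
  then show "g \<in> carrier (GL \<Delta>)" by (simp add: GL_def units_of_def)
qed

section \<open>The action of the nonzero elements of \<D> on vertices, orders and radicals\<close>

lemma vertex_act_in_vertices:
  assumes g: "g \<noteq> 0" and s: "s \<in> vertices N \<Delta> \<omega>"
  shows "vertex_act (lmult g) s \<in> vertices N \<Delta> \<omega>"
proof -
  obtain L where s: "s = lattice_class \<omega> L" and L: "lattice N \<Delta> L"
    using s by (auto simp: vertices_def)
  obtain B where B: "finite B" "L = right_span \<O> B" "right_span \<Delta> B = UNIV"
    using L by (auto simp: lattice_def)
  have "x = g * (inverse g * x)" for x using g by (simp add: mult.assoc[symmetric])
  then have surj: "(*) g ` UNIV = UNIV" unfolding surj_def by blast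
  have "lattice N \<Delta> ((*) g ` L)"
    unfolding lattice_def
    using B surj right_span_image_mult[OF g] by (intro exI[of _ "(*) g ` B"]) auto
  moreover have class_eq: "lattice_class \<omega> M = range (\<lambda>i. (\<lambda>x. x * \<omega> powi i) ` M)" for M
    by (auto simp: lattice_class_def)
  have "vertex_act (lmult g) s = lattice_class \<omega> ((*) g ` L)"
    by (simp add: s vertex_act_def lmult_def class_eq image_image mult.assoc)
  ultimately show ?thesis by (auto simp: vertices_def)
qed

lemma lmult_conj_stable:
  assumes g: "g \<noteq> 0" and a: "a \<in> carrier (hereditary_order \<Delta> \<sigma>)"
  shows "(\<lambda>x. g * a (inverse g * x)) \<in> carrier (hereditary_order \<Delta> (vertex_act (lmult g) ` \<sigma>))"
proof -
  have "(\<lambda>x. g * a (inverse g * x)) \<in> carrier (End_ring \<Delta>)"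
    using a by (auto simp: carrier_hereditary_order End_ring_def distrib_left mult.assoc[symmetric])
  moreover have "(\<lambda>x. g * a (inverse g * x)) ` lmult g ` L \<subseteq> lmult g ` L" if "s \<in> \<sigma>" "L \<in> s" for s L
  proof -
    have "g * a (inverse g * (g * x)) \<in> lmult g ` L" if "x \<in> L" for x
    proof -
      have "a x \<in> L" using a \<open>s \<in> \<sigma>\<close> \<open>L \<in> s\<close> that by (auto simp: carrier_hereditary_order)
      then show ?thesis using g by (simp add: lmult_def mult.assoc[symmetric])
    qed
    then show ?thesis by (auto simp: lmult_def)
  qed
  ultimately show ?thesis by (auto simp: carrier_hereditary_order vertex_act_def)
qed

lemma vertex_act_inverse:
  assumes "g \<noteq> 0"
  shows "vertex_act (lmult (inverse g)) (vertex_act (lmult g) s) = s"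
    "vertex_act (lmult g) (vertex_act (lmult (inverse g)) s) = s"
  using assms by (simp_all add: vertex_act_def lmult_def image_image mult.assoc[symmetric])

text \<open>Conjugation by \<open>lmult g\<close> identifies the two orders: pull the test element
  \<open>r\<close> back to the order of \<sigma>, then push the resulting left inverse
  forward.\<close>

lemma jacobson_radical_conj:
  assumes g: "g \<noteq> 0" and \<sigma>: "\<sigma> \<subseteq> vertices N \<Delta> \<omega>"
    and p: "p \<in> jacobson_radical (hereditary_order \<Delta> \<sigma>)"
  shows "(\<lambda>x. g * p (inverse g * x)) \<in> jacobson_radical (hereditary_order \<Delta> (vertex_act (lmult g) ` \<sigma>))"
proof -
  let ?g\<sigma> = "vertex_act (lmult g) ` \<sigma>"
  have g\<sigma>: "?g\<sigma> \<subseteq> vertices N \<Delta> \<omega>" using vertex_act_in_vertices[OF g] \<sigma> by blast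
  note J = jacobson_radical_hereditary_order[OF \<sigma>]
  have inv_act: "vertex_act (lmult (inverse g)) ` ?g\<sigma> = \<sigma>"
    by (simp add: image_image vertex_act_inverse[OF g])
  have pA: "p \<in> carrier (hereditary_order \<Delta> \<sigma>)" using p J by blast
  have "\<exists>u\<in>carrier (hereditary_order \<Delta> ?g\<sigma>). \<forall>x. u (x - r (g * p (inverse g * x))) = x"
    if r: "r \<in> carrier (hereditary_order \<Delta> ?g\<sigma>)" for r
  proof -
    have "(\<lambda>x. inverse g * r (g * x)) \<in> carrier (hereditary_order \<Delta> \<sigma>)"
      using lmult_conj_stable[of "inverse g", OF _ r] g unfolding inv_act by simp
    then obtain u where u: "u \<in> carrier (hereditary_order \<Delta> \<sigma>)"
      "\<And>x. u (x - inverse g * r (g * p x)) = x"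
      by (rule jacobson_radicalE[OF \<sigma> p]) auto
    have "g * u (inverse g * (x - r (g * p (inverse g * x)))) = x" for x
      using u(2)[of "inverse g * x"] g by (simp add: right_diff_distrib mult.assoc[symmetric])
    then show ?thesis using lmult_conj_stable[OF g u(1)] by (intro bexI) simp_all
  qed
  then show ?thesis
    unfolding jacobson_radical_hereditary_order[OF g\<sigma>] using lmult_conj_stable[OF g pA] by simp
qed

end

section \<open>Chains with coefficients in a representation\<close>

text \<open>The inclusion of a summand into the direct sum. As an abbreviation it agrees
  syntactically with the argument of \<phi> in \<open>component\<close>.\<close>

abbreviation single :: "'i \<Rightarrow> 'v::zero \<Rightarrow> 'i \<Rightarrow> 'v" where
  "single s v \<equiv> (\<lambda>t. if t = s then v else 0)"

locale tree_representation = valued_division_subring N \<Delta> \<omega>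
  for N :: "'d::division_ring \<Rightarrow> real" and \<Delta> \<omega> +
  fixes scl :: "complex \<Rightarrow> 'v::ab_group_add \<Rightarrow> 'v" and \<pi> :: "('d \<Rightarrow> 'd) \<Rightarrow> 'v \<Rightarrow> 'v"
  assumes rep: "group_rep scl (GL \<Delta>) \<pi>"
begin

abbreviation "X0 \<equiv> vertices N \<Delta> \<omega>"
abbreviation "adj \<equiv> adjacent N \<Delta> \<omega>"
abbreviation "VV \<equiv> V_at \<Delta> \<pi>"
abbreviation act :: "'d \<Rightarrow> 'd set set \<Rightarrow> 'd set set" where "act g \<equiv> vertex_act (lmult g)"

sublocale V: vector_space scl
  using rep by (simp add: group_rep_def)

lemma rep_linear:
  assumes "g \<in> carrier (GL \<Delta>)"
  shows "\<pi> g (x + y) = \<pi> g x + \<pi> g y" "\<pi> g 0 = 0" "\<pi> g (- x) = - \<pi> g x"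
proof -
  interpret Vector_Spaces.linear scl scl "\<pi> g" using rep assms by (simp add: group_rep_def)
  show "\<pi> g (x + y) = \<pi> g x + \<pi> g y" "\<pi> g 0 = 0" "\<pi> g (- x) = - \<pi> g x"
    by (simp_all add: add zero neg)
qed

lemma rep_comp:
  assumes "g \<in> carrier (GL \<Delta>)" "h \<in> carrier (GL \<Delta>)"
  shows "\<pi> (g \<circ> h) v = \<pi> g (\<pi> h v)"
proof -
  have "g \<otimes>\<^bsub>GL \<Delta>\<^esub> h = g \<circ> h" by (simp add: GL_def units_of_mult End_ring_simps)
  then show ?thesis using rep assms by (metis comp_apply group_rep_def)
qed

lemma inv_lmult:
  assumes "g \<noteq> 0"
  shows "inv\<^bsub>GL \<Delta>\<^esub> (lmult g) = lmult (inverse g)"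
proof -
  interpret ring "End_ring \<Delta>" by (rule End_ring_ring)
  interpret group "GL \<Delta>" unfolding GL_def by (rule units_group)
  have "lmult (inverse g) \<circ> lmult g = id"
    using assms by (simp add: fun_eq_iff lmult_def mult.assoc[symmetric])
  then show ?thesis
    using lmult_in_GL[OF assms, of \<Delta>] lmult_in_GL[of "inverse g" \<Delta>] assms
    by (intro inv_equality) (simp_all add: GL_def units_of_mult units_of_one End_ring_simps)
qed

section \<open>Fixed vectors at vertices and edges\<close>

lemma V_at_closed:
  assumes "\<sigma> \<subseteq> X0"
  shows "0 \<in> VV \<sigma>" "v \<in> VV \<sigma> \<Longrightarrow> v' \<in> VV \<sigma> \<Longrightarrow> v + v' \<in> VV \<sigma>" "v \<in> VV \<sigma> \<Longrightarrow> - v \<in> VV \<sigma>"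
  using rep_linear[OF subsetD[OF U1_subset_GL[OF assms]]]
  by (auto simp: V_at_def fixed_vectors_def)

lemma adjD:
  assumes "adj s t"
  shows "s \<in> X0" "t \<in> X0"
  using assms by (auto simp: adjacent_def)

text \<open>Passing to fixed vectors reverses the inclusion of radicals; symmetry of adjacency gives
  the second endpoint.\<close>

lemma V_at_edge:
  assumes "adj s t"
  shows "VV {s, t} \<subseteq> VV {s}" "VV {s, t} \<subseteq> VV {t}"
proof -
  have *: "VV {a, b} \<subseteq> VV {a}" if "adj a b" for a b
    using jacobson_radical_vertex_subset_edge[OF that]
    by (auto simp: V_at_def fixed_vectors_def U1_def)
  show "VV {s, t} \<subseteq> VV {s}" by (rule *[OF assms])
  show "VV {s, t} \<subseteq> VV {t}"
    using *[OF adjacent_sym[OF assms]] by (simp add: insert_commute)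
qed

text \<open>For \<open>u\<close> in the group of the moved vertex, its conjugate \<open>u'\<close>
  by \<open>lmult g\<close> is in the group of \<open>s\<close> and satisfies
  \<open>u g = g u'\<close>, so \<open>u\<close> fixes the moved vector because \<open>u'\<close>
  fixes \<open>v\<close>.\<close>

lemma V_at_act:
  assumes g: "g \<noteq> 0" and s: "s \<in> X0" and v: "v \<in> VV {s}"
  shows "\<pi> (lmult g) v \<in> VV {act g s}"
  unfolding V_at_def fixed_vectors_def
proof (intro CollectI ballI)
  fix u assume u: "u \<in> U1 \<Delta> {act g s}"
  then obtain p where p: "u = (\<lambda>x. x + p x)" "p \<in> jacobson_radical (hereditary_order \<Delta> {act g s})"
    by (auto simp: U1_def)
  have gs: "{act g s} \<subseteq> X0" using vertex_act_in_vertices[OF g s] by simp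
  define u' where "u' = (\<lambda>x. x + inverse g * p (g * x))"
  have "(\<lambda>x. inverse g * p (g * x)) \<in> jacobson_radical (hereditary_order \<Delta> {s})"
    using jacobson_radical_conj[OF _ gs p(2), of "inverse g"] g by (simp add: vertex_act_inverse[OF g])
  then have u': "u' \<in> U1 \<Delta> {s}" by (auto simp: U1_def u'_def)
  have GL: "u \<in> carrier (GL \<Delta>)" "u' \<in> carrier (GL \<Delta>)" "lmult g \<in> carrier (GL \<Delta>)"
    using U1_subset_GL[OF gs] U1_subset_GL[of "{s}"] u u' s lmult_in_GL[OF g] by auto
  have "u \<circ> lmult g = lmult g \<circ> u'"
    using g by (auto simp: fun_eq_iff p(1) u'_def lmult_def distrib_left mult.assoc[symmetric])
  then have "\<pi> u (\<pi> (lmult g) v) = \<pi> (lmult g) (\<pi> u' v)"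
    using GL by (simp flip: rep_comp)
  also have "\<pi> u' v = v" using v u' by (simp add: V_at_def fixed_vectors_def)
  finally show "\<pi> u (\<pi> (lmult g) v) = \<pi> (lmult g) v" .
qed

section \<open>Zero-chains and the action on them\<close>

abbreviation "C0' \<equiv> C0 N \<Delta> \<omega> \<pi>"

lemma single_in_C0:
  assumes "s \<in> X0" "v \<in> VV {s}"
  shows "single s v \<in> C0'"
  using assms V_at_closed(1) by (auto simp: C0_def)

lemma zero_in_C0: "(\<lambda>s. 0) \<in> C0'"
  using V_at_closed(1) by (auto simp: C0_def)

lemma add_in_C0:
  assumes "x \<in> C0'" "y \<in> C0'"
  shows "(\<lambda>s. x s + y s) \<in> C0'"
proof -
  have "{s. x s + y s \<noteq> 0} \<subseteq> {s. x s \<noteq> 0} \<union> {s. y s \<noteq> 0}" by auto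
  then have "finite {s. x s + y s \<noteq> 0}"
    using assms by (auto simp: C0_def intro: finite_subset)
  then show ?thesis using assms V_at_closed(2) by (simp add: C0_def)
qed

lemma sum_in_C0:
  assumes "finite E" "\<And>e. e \<in> E \<Longrightarrow> f e \<in> C0'"
  shows "(\<lambda>s. \<Sum>e\<in>E. f e s) \<in> C0'"
  using assms by (induction E rule: finite_induct) (auto simp: zero_in_C0 add_in_C0)

text \<open>The support is moved by \<open>g\<close> and stays finite, and the values land in the
  right spaces by \<open>V_at_act\<close>.\<close>

lemma C0_act_in_C0:
  assumes g: "g \<noteq> 0" and x: "x \<in> C0'"
  shows "C0_act \<Delta> \<pi> (lmult g) x \<in> C0'"
proof -
  let ?y = "C0_act \<Delta> \<pi> (lmult g) x"
  have y: "?y s = \<pi> (lmult g) (x (act (inverse g) s))" for s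
    by (simp add: C0_act_def inv_lmult[OF g])
  note lin = rep_linear[OF lmult_in_GL[OF g, of \<Delta>]]
  have ig: "inverse g \<noteq> 0" using g by simp
  have "{s. ?y s \<noteq> 0} \<subseteq> act g ` {s. x s \<noteq> 0}"
  proof
    fix s assume "s \<in> {s. ?y s \<noteq> 0}"
    then have "x (act (inverse g) s) \<noteq> 0" using lin(2) by (auto simp: y)
    then show "s \<in> act g ` {s. x s \<noteq> 0}"
      by (intro image_eqI[of _ _ "act (inverse g) s"]) (simp_all add: vertex_act_inverse(2)[OF g])
  qed
  then have "finite {s. ?y s \<noteq> 0}"
    by (rule finite_subset) (use x in \<open>simp add: C0_def\<close>)
  moreover have "?y s \<in> VV {s}" if "s \<in> X0" for s
  proof -
    have s': "act (inverse g) s \<in> X0" by (rule vertex_act_in_vertices[OF ig that])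
    then have "x (act (inverse g) s) \<in> VV {act (inverse g) s}"
      using x by (simp add: C0_def)
    from V_at_act[OF g s' this] show ?thesis by (simp add: y vertex_act_inverse(2)[OF g])
  qed
  moreover have "?y s = 0" if "s \<notin> X0" for s
  proof -
    have "act (inverse g) s \<notin> X0"
      using vertex_act_in_vertices[OF g, of "act (inverse g) s"] that
      by (auto simp: vertex_act_inverse(2)[OF g])
    then show ?thesis using x lin(2) by (simp add: y C0_def)
  qed
  ultimately show ?thesis by (simp add: C0_def)
qed

lemma C0_act_single:
  assumes "g \<noteq> 0"
  shows "C0_act \<Delta> \<pi> (lmult g) (single s v) = single (act g s) (\<pi> (lmult g) v)"
proof
  fix t
  have "act (inverse g) t = s \<longleftrightarrow> t = act g s"
    using vertex_act_inverse[OF assms] by metis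
  then show "C0_act \<Delta> \<pi> (lmult g) (single s v) t = single (act g s) (\<pi> (lmult g) v) t"
    using rep_linear(2)[OF lmult_in_GL[OF assms, of \<Delta>]]
    by (simp add: C0_act_def inv_lmult[OF assms])
qed

lemma C0_eq_sum_single:
  assumes "finite A" "{s. x s \<noteq> 0} \<subseteq> A"
  shows "x = (\<lambda>t. \<Sum>s\<in>A. single s (x s) t)"
proof
  fix t
  have "(\<Sum>s\<in>A. single s (x s) t) = (if t \<in> A then x t else 0)"
    using assms(1) by simp
  then show "x t = (\<Sum>s\<in>A. single s (x s) t)" using assms(2) by auto
qed

section \<open>Linear forms on zero-chains and their components\<close>

context
  fixes \<phi> :: "('d set set \<Rightarrow> 'v) \<Rightarrow> complex"
  assumes \<phi>: "linear_form_on scl C0' \<phi>"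
begin

lemma form_add: "x \<in> C0' \<Longrightarrow> y \<in> C0' \<Longrightarrow> \<phi> (\<lambda>s. x s + y s) = \<phi> x + \<phi> y"
  using \<phi> by (simp add: linear_form_on_def)

lemma form_zero: "\<phi> (\<lambda>s. 0) = 0"
proof -
  have "\<forall>c. \<forall>x\<in>C0'. \<phi> (\<lambda>i. scl c (x i)) = c * \<phi> x"
    using \<phi> by (simp add: linear_form_on_def)
  from bspec[OF spec[OF this, of 0] zero_in_C0] show ?thesis by simp
qed

lemma form_sum:
  assumes "finite E" "\<And>e. e \<in> E \<Longrightarrow> f e \<in> C0'"
  shows "\<phi> (\<lambda>s. \<Sum>e\<in>E. f e s) = (\<Sum>e\<in>E. \<phi> (f e))"
  using assms
proof (induction E rule: finite_induct)
  case (insert e E)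
  then have "(\<lambda>s. \<Sum>e\<in>E. f e s) \<in> C0'" by (intro sum_in_C0) auto
  then show ?case using insert by (simp add: form_add)
qed (simp add: form_zero)

lemma component_minus:
  assumes "s \<in> X0" "v \<in> VV {s}"
  shows "component \<phi> s (- v) = - component \<phi> s v"
proof -
  have "- v \<in> VV {s}" using assms V_at_closed(3)[of "{s}"] by simp
  then have "\<phi> (\<lambda>t. single s v t + single s (- v) t) = component \<phi> s v + component \<phi> s (- v)"
    unfolding component_def using assms by (intro form_add single_in_C0)
  moreover have "(\<lambda>t. single s v t + single s (- v) t) = (\<lambda>t. 0)" by auto
  ultimately show ?thesis using form_zero by (simp add: eq_neg_iff_add_eq_0 add.commute)
qed

text \<open>A form on a direct sum is determined by its restrictions to the summands. Linearity is
  only available on \<open>C0'\<close>, so each summand of the chain has to be placed there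
  first.\<close>

lemma form_eq_sum_component:
  assumes x: "x \<in> C0'" and A: "finite A" "{s. x s \<noteq> 0} \<subseteq> A"
  shows "\<phi> x = (\<Sum>s\<in>A. component \<phi> s (x s))"
proof -
  have "single s (x s) \<in> C0'" for s
  proof (cases "s \<in> X0")
    case True
    then show ?thesis using x by (intro single_in_C0) (auto simp: C0_def)
  next
    case False
    then have "single s (x s) = (\<lambda>s. 0)" using x by (auto simp: C0_def)
    then show ?thesis using zero_in_C0 by simp
  qed
  then have "\<phi> (\<lambda>t. \<Sum>s\<in>A. single s (x s) t) = (\<Sum>s\<in>A. component \<phi> s (x s))"
    unfolding component_def by (intro form_sum[OF A(1)])
  then show ?thesis using C0_eq_sum_single[OF A] by simp
qed

lemma C1_edge:
  assumes "w \<in> C1 N \<Delta> \<omega> \<pi>" "w (s, t) \<noteq> 0"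
  shows "adj s t" "w (s, t) \<in> VV {s, t}" "w (t, s) = - w (s, t)"
proof -
  have "if adj s t then w (s, t) \<in> VV {s, t} \<and> w (s, t) = - w (t, s) else w (s, t) = 0"
    using assms(1) unfolding C1_def by blast
  with assms(2) show "adj s t" "w (s, t) \<in> VV {s, t}" "w (t, s) = - w (s, t)"
    by (auto split: if_splits)
qed

text \<open>The boundary collects the value on an oriented edge at its second vertex. Regrouping by
  edges instead of vertices turns the form into one sum over oriented edges.\<close>

lemma form_boundary:
  assumes w: "w \<in> C1 N \<Delta> \<omega> \<pi>" and E: "finite E" "{e. w e \<noteq> 0} \<subseteq> E"
  shows "\<phi> (boundary N \<Delta> \<omega> w) = (\<Sum>e\<in>E. component \<phi> (snd e) (w e))"
proof -
  have "boundary N \<Delta> \<omega> w s = (\<Sum>e\<in>E. single (snd e) (w e) s)" for s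
  proof -
    have "boundary N \<Delta> \<omega> w s = (\<Sum>e | snd e = s \<and> w e \<noteq> 0. w e)"
      unfolding boundary_def
      \<comment> \<open>A neighbour \<open>t\<close> corresponds to the edge \<open>(t, s)\<close>;
        adjacency is automatic where \<open>w\<close> does not vanish.\<close>
      by (rule sum.reindex_bij_witness[of _ fst "\<lambda>t. (t, s)"]) (auto simp: C1_edge(1)[OF w])
    also have "\<dots> = (\<Sum>e\<in>E. if s = snd e then w e else 0)"
      using E by (intro sum.mono_neutral_cong_left) auto
    finally show ?thesis .
  qed
  then have "boundary N \<Delta> \<omega> w = (\<lambda>s. \<Sum>e\<in>E. single (snd e) (w e) s)" by (rule ext)
  moreover have "single (snd e) (w e) \<in> C0'" for e
  proof (cases "w e = 0")
    case True
    then have "single (snd e) (w e) = (\<lambda>s. 0)" by auto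
    then show ?thesis using zero_in_C0 by simp
  next
    case False
    obtain s t where e: "e = (s, t)" by fastforce
    have "adj s t" "w e \<in> VV {s, t}" using C1_edge(1,2)[OF w, of s t] False e by simp_all
    then have "t \<in> X0" "w e \<in> VV {t}" using V_at_edge(2) adjD(2) by blast+
    then show ?thesis by (simp add: e single_in_C0)
  qed
  ultimately show ?thesis using form_sum[OF E(1)] by (simp add: component_def)
qed

lemma compatible_iff_ker:
  "(\<forall>w\<in>C1 N \<Delta> \<omega> \<pi>. coboundary N \<Delta> \<omega> \<phi> w = 0) \<longleftrightarrow>
   (\<forall>s t. adj s t \<longrightarrow> (\<forall>v\<in>VV {s, t}. component \<phi> s v = component \<phi> t v))"
proof (intro iffI allI impI ballI)
  fix s t v
  assume ker: "\<forall>w\<in>C1 N \<Delta> \<omega> \<pi>. coboundary N \<Delta> \<omega> \<phi> w = 0" and st: "adj s t" and v: "v \<in> VV {s, t}"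
  show "component \<phi> s v = component \<phi> t v"
  \<comment> \<open>For \<open>s = t\<close> the claim is trivial; otherwise the two orientations
    are distinct pairs, as the definition of \<open>w\<close> requires.\<close>
  proof (cases "s = t")
    case False
    \<comment> \<open>Its boundary is \<open>v\<close> at \<open>s\<close> and \<open>- v\<close> at
      \<open>t\<close>.\<close>
    define w where "w = (\<lambda>e. if e = (t, s) then v else if e = (s, t) then - v else 0)"
    have sub: "{s, t} \<subseteq> X0" using adjD[OF st] by simp
    have "{e. w e \<noteq> 0} \<subseteq> {(t, s), (s, t)}" by (auto simp: w_def)
    then have supp: "{e. w e \<noteq> 0} \<subseteq> {(t, s), (s, t)}" "finite {e. w e \<noteq> 0}"
      by (auto intro: finite_subset)
    have w: "w \<in> C1 N \<Delta> \<omega> \<pi>"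
      unfolding C1_def
    proof (intro CollectI conjI allI)
      fix a b
      consider "a = t" "b = s" | "a = s" "b = t" | "(a, b) \<noteq> (t, s)" "(a, b) \<noteq> (s, t)" by auto
      then show "if adj a b then w (a, b) \<in> VV {a, b} \<and> w (a, b) = - w (b, a) else w (a, b) = 0"
      proof cases
        case 1
        then show ?thesis using st adjacent_sym v False by (auto simp: w_def insert_commute)
      next
        case 2
        then show ?thesis using st v False V_at_closed(3)[OF sub] by (auto simp: w_def)
      next
        case 3
        then have "w (a, b) = 0" "w (b, a) = 0" by (auto simp: w_def)
        then show ?thesis using V_at_closed(1)[of "{a, b}"] adjD[of a b] by auto
      qed
    qed (rule supp(2))
    have "component \<phi> s v + component \<phi> t (- v) = (\<Sum>e\<in>{(t, s), (s, t)}. component \<phi> (snd e) (w e))"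
      using False by (simp add: w_def)
    also have "\<dots> = 0"
      using form_boundary[OF w _ supp(1)] ker w by (simp add: coboundary_def)
    finally show ?thesis
      using component_minus[OF adjD(2)[OF st], of v] V_at_edge(2)[OF st] v by auto
  qed simp
next
  fix w
  assume comp: "\<forall>s t. adj s t \<longrightarrow> (\<forall>v\<in>VV {s, t}. component \<phi> s v = component \<phi> t v)"
    and w: "w \<in> C1 N \<Delta> \<omega> \<pi>"
  define E where "E = {e. w e \<noteq> 0}"
  define T where "T = (\<Sum>e\<in>E. component \<phi> (snd e) (w e))"
  have fin: "finite E" using w by (simp add: C1_def E_def)
  \<comment> \<open>Reversing an edge exchanges its ends, between which the components agree by
    compatibility, and negates \<open>w\<close>.\<close>
  have edge: "prod.swap e \<in> E \<and> component \<phi> (snd (prod.swap e)) (w (prod.swap e)) = - component \<phi> (snd e) (w e)"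
    if "e \<in> E" for e
  proof -
    obtain s t where e: "e = (s, t)" by fastforce
    have "w (s, t) \<noteq> 0" using that e by (simp add: E_def)
    note C = C1_edge[OF w this]
    have "component \<phi> s (w (s, t)) = component \<phi> t (w (s, t))" using comp C by blast
    moreover have "component \<phi> s (- w (s, t)) = - component \<phi> s (w (s, t))"
      using C V_at_edge(1) adjD(1) by (intro component_minus) auto
    ultimately show ?thesis using that C(3) by (simp add: e E_def)
  qed
  have "T = (\<Sum>e\<in>E. component \<phi> (snd (prod.swap e)) (w (prod.swap e)))"
    unfolding T_def by (rule sum.reindex_bij_witness[of _ prod.swap prod.swap]) (use edge in auto)
  also have "\<dots> = - T"
    using edge by (simp add: T_def flip: sum_negf)
  finally have "T = 0" by simp
  then show "coboundary N \<Delta> \<omega> \<phi> w = 0"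
    using form_boundary[OF w fin] by (simp add: coboundary_def T_def E_def)
qed

text \<open>Invariance is tested on chains supported at one vertex. Conversely, \<open>g\<close>
  permutes the vertices, so the sum of components of the moved chain is a reindexing of the original
  sum.\<close>

lemma Hom_C0_iff:
  "\<phi> \<in> Hom_C0 scl N \<Delta> \<omega> \<pi> \<longleftrightarrow>
    (\<forall>g. g \<noteq> 0 \<longrightarrow> (\<forall>s\<in>X0. \<forall>v\<in>VV {s}. component \<phi> s v = component \<phi> (act g s) (\<pi> (lmult g) v)))"
proof (intro iffI allI impI ballI)
  fix g :: 'd and s v
  assume H: "\<phi> \<in> Hom_C0 scl N \<Delta> \<omega> \<pi>" and g: "g \<noteq> 0" and s: "s \<in> X0" "v \<in> VV {s}"
  have "\<phi> (C0_act \<Delta> \<pi> (lmult g) (single s v)) = \<phi> (single s v)"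
    using H g single_in_C0[OF s] by (simp add: Hom_C0_def)
  then show "component \<phi> s v = component \<phi> (act g s) (\<pi> (lmult g) v)"
    unfolding C0_act_single[OF g] by (simp add: component_def)
next
  assume inv: "\<forall>g. g \<noteq> 0 \<longrightarrow> (\<forall>s\<in>X0. \<forall>v\<in>VV {s}. component \<phi> s v = component \<phi> (act g s) (\<pi> (lmult g) v))"
  have "\<phi> (C0_act \<Delta> \<pi> (lmult g) x) = \<phi> x" if g: "g \<noteq> 0" and x: "x \<in> C0'" for g x
  proof -
    define A where "A = {s. x s \<noteq> 0}"
    have fin: "finite A" and AX: "A \<subseteq> X0"
      using x by (auto simp: C0_def A_def split: if_splits)
    have inj: "inj_on (act g) A"
      by (rule inj_on_inverseI[of _ "act (inverse g)"]) (rule vertex_act_inverse(1)[OF g])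
    let ?y = "C0_act \<Delta> \<pi> (lmult g) x"
    have y: "?y (act g s) = \<pi> (lmult g) (x s)" for s
      by (simp add: C0_act_def inv_lmult[OF g] vertex_act_inverse[OF g])
    have "{s. ?y s \<noteq> 0} \<subseteq> act g ` A"
    proof
      fix s assume "s \<in> {s. ?y s \<noteq> 0}"
      then have "\<pi> (lmult g) (x (act (inverse g) s)) \<noteq> 0"
        by (simp add: C0_act_def inv_lmult[OF g])
      then have "act (inverse g) s \<in> A"
        using rep_linear(2)[OF lmult_in_GL[OF g, of \<Delta>]] by (auto simp: A_def)
      then show "s \<in> act g ` A"
        by (rule image_eqI[rotated]) (simp add: vertex_act_inverse(2)[OF g])
    qed
    then have "\<phi> ?y = (\<Sum>s\<in>act g ` A. component \<phi> s (?y s))"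
      using fin C0_act_in_C0[OF g x] by (intro form_eq_sum_component) auto
    also have "\<dots> = (\<Sum>s\<in>A. component \<phi> (act g s) (\<pi> (lmult g) (x s)))"
      by (simp add: sum.reindex[OF inj] y)
    also have "\<dots> = (\<Sum>s\<in>A. component \<phi> s (x s))"
    proof (rule sum.cong)
      fix s assume "s \<in> A"
      then have s: "s \<in> X0" using AX by blast
      then have "x s \<in> VV {s}" using x by (simp add: C0_def)
      then show "component \<phi> (act g s) (\<pi> (lmult g) (x s)) = component \<phi> s (x s)"
        using inv g s by simp
    qed simp
    also have "\<dots> = \<phi> x"
      by (rule form_eq_sum_component[OF x fin, symmetric]) (simp add: A_def)
    finally show ?thesis .
  qed
  then show "\<phi> \<in> Hom_C0 scl N \<Delta> \<omega> \<pi>" using \<phi> by (simp add: Hom_C0_def)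
qed

end

end

text \<open>These are the closure axioms of \<open>valued_division_subring\<close> for \<Delta>; the
  case \<open>x = 0\<close> of the last one rests on \<open>inverse 0 = 0\<close>.\<close>

lemma centralizer_closed:
  fixes S :: "'d::division_ring set"
  shows "1 \<in> centralizer S" "x \<in> centralizer S \<Longrightarrow> y \<in> centralizer S \<Longrightarrow> x - y \<in> centralizer S"
    "x \<in> centralizer S \<Longrightarrow> y \<in> centralizer S \<Longrightarrow> x * y \<in> centralizer S"
    "x \<in> centralizer S \<Longrightarrow> inverse x \<in> centralizer S"
proof -
  show "1 \<in> centralizer S" by (simp add: centralizer_def)
  show "x \<in> centralizer S \<Longrightarrow> y \<in> centralizer S \<Longrightarrow> x - y \<in> centralizer S"
    by (simp add: centralizer_def algebra_simps)
  show "x * y \<in> centralizer S" if "x \<in> centralizer S" "y \<in> centralizer S"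
    unfolding centralizer_def
  proof (intro CollectI ballI)
    fix k assume "k \<in> S"
    then have "x * k = k * x" "y * k = k * y" using that by (auto simp: centralizer_def)
    then show "x * y * k = k * (x * y)" by (metis mult.assoc)
  qed
  show "inverse x \<in> centralizer S" if "x \<in> centralizer S"
    unfolding centralizer_def
  proof (intro CollectI ballI)
    fix k assume "k \<in> S"
    then have "x * k = k * x" using that by (auto simp: centralizer_def)
    then show "inverse x * k = k * inverse x"
      by (rule mult_commute_imp_mult_inverse_commute)
  qed
qed

theorem proposition3p2p3:
  fixes iF :: "'f::field \<Rightarrow> 'k::field"
    and iK :: "'k \<Rightarrow> 'd::division_ring"
    and N :: "'d \<Rightarrow> real"
    and n :: nat
    and \<Delta> :: "'d set"
    and \<omega> :: 'd
    and scl :: "complex \<Rightarrow> 'v::ab_group_add \<Rightarrow> 'v"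
    and \<pi> :: "('d \<Rightarrow> 'd) \<Rightarrow> 'v \<Rightarrow> 'v"
    and \<phi> :: "('d set set \<Rightarrow> 'v) \<Rightarrow> complex"
  assumes "nonarch_abs N"
    and "local_field (N \<circ> iK \<circ> iF)" and "local_field (N \<circ> iK)"
    and "unital_hom iF" and "extension_degree iF = 2" and "separable_extension iF"
    and "tamely_ramified (N \<circ> iK \<circ> iF) (N \<circ> iK)"
    and "unital_hom iK" and "central_division_algebra_of_index (iK \<circ> iF) n" and "even n"
    and "\<Delta> = centralizer (range iK)" and "uniformizer N \<Delta> \<omega>"
    and "group_rep scl (GL \<Delta>) \<pi>"
    and "smooth_rep (GL \<Delta>) (GL_topology N \<Delta>) \<pi>"
    and "irreducible_rep scl (GL \<Delta>) \<pi>"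
    and "discrete_series scl (GL \<Delta>) (GL_topology N \<Delta>) \<pi>"
    and "level_zero N \<Delta> \<omega> \<pi>"
    and "\<not> cuspidal scl \<Delta> \<pi>"
    and "linear_form_on scl (C0 N \<Delta> \<omega> \<pi>) \<phi>"
  shows "\<phi> \<in> Hom_C0 scl N \<Delta> \<omega> \<pi> \<inter> ker_coboundary scl N \<Delta> \<omega> \<pi> \<longleftrightarrow>
    (\<forall>s t. adjacent N \<Delta> \<omega> s t \<longrightarrow>
       (\<forall>v\<in>V_at \<Delta> \<pi> {s, t}. component \<phi> s v = component \<phi> t v)) \<and>
    (\<forall>g. g \<noteq> 0 \<longrightarrow> (\<forall>s\<in>vertices N \<Delta> \<omega>. \<forall>v\<in>V_at \<Delta> \<pi> {s}.
       component \<phi> s v = component \<phi> (vertex_act (lmult g) s) (\<pi> (lmult g) v)))"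
proof -
  interpret tree_representation N \<Delta> \<omega> scl \<pi>
    using assms(1,11-13) centralizer_closed by unfold_locales auto
  show ?thesis
    \<comment> \<open>The kernel is defined inside \<open>Hom_C0\<close>, so the intersection
      unfolds to invariance, which is (ii), together with vanishing on boundaries, which is
      (i).\<close>
    using Hom_C0_iff[OF assms(19)] compatible_iff_ker[OF assms(19)]
    by (auto simp: ker_coboundary_def)
qed

end
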